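(* Let $1/n\ll1/C\ll\alpha,\beta\ll\varepsilon\ll\lambda,\varepsilon'\ll1$ with $n$ even. Suppose $D$ is an $n$-vertex oriented graph with $\mathrm{ex}(D)\ge Cn$, $\delta(D)\ge(1-\varepsilon)n$ and $1\le|\mathrm{ex}_D(v)|\le\alpha n$ for all $v\in V(D)$, and suppose $D$ has no perfect decomposition. Then there is a subgraph $D'$ of $D$ such that: (i) $D'$ has no perfect decomposition; (ii) $|D'|\ge(1-\beta)n$ with $|D'|$ even; (iii) $\delta(D')\ge(1-\varepsilon'/2)n\ge(1-\varepsilon')|D'|$; (iv) $1\le|\mathrm{ex}_{D'}(v)|\le\alpha n\le2\alpha|D'|$ for all $v\in V(D')$; (v) $\mathrm{ex}(D')\ge\lambda Cn/32\ge\lambda C|D'|/32$; (vi) $\big||U^-(D')|-|U^+(D')|\big|\le2\lambda|D'|$.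
   Context: Hierarchy convention: $a\ll b$ means the statement holds whenever $a\le f(b)$ for some implicit non-decreasing $f:(0,1]\to(0,1]$; chains are read right to left (so $C$ is large). An oriented graph has no loops and at most one edge between two vertices. $|D|$ is the number of vertices, $d_D(v)=d^+_D(v)+d^-_D(v)$, $\delta(D)=\min_v d_D(v)$, $\mathrm{ex}_D(v)=d^+_D(v)-d^-_D(v)$, $\mathrm{ex}(D)=\sum_v\max\{\mathrm{ex}_D(v),0\}$, $U^+(D)=\{v:\mathrm{ex}_D(v)>0\}$, $U^-(D)=\{v:\mathrm{ex}_D(v)<0\}$. Paths are directed; a perfect decomposition of $D$ is a set of exactly $\mathrm{ex}(D)$ paths of $D$ whose edge sets partition $E(D)$. *)

theory Defs
  imports
    Complex_Main
    "HOL-Library.Disjoint_Sets"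
    "Graph_Theory.Pair_Digraph"
    "Graph_Theory.Digraph_Component"
begin

locale oriented_graph = pair_digraph +
  assumes no_antiparallel: "(u, v) \<in> parcs G \<Longrightarrow> (v, u) \<notin> parcs G"

definition total_degree :: "'a pair_pre_digraph \<Rightarrow> 'a \<Rightarrow> nat" where
  "total_degree D v = out_degree (with_proj D) v + in_degree (with_proj D) v"

definition min_degree :: "'a pair_pre_digraph \<Rightarrow> nat" where
  "min_degree D = Min (total_degree D ` pverts D)"

definition vertex_excess :: "'a pair_pre_digraph \<Rightarrow> 'a \<Rightarrow> int" where
  "vertex_excess D v = int (out_degree (with_proj D) v) - int (in_degree (with_proj D) v)"

definition excess :: "'a pair_pre_digraph \<Rightarrow> int" where
  "excess D = (\<Sum>v\<in>pverts D. max (vertex_excess D v) 0)"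

definition U_plus :: "'a pair_pre_digraph \<Rightarrow> 'a set" where
  "U_plus D = {v \<in> pverts D. vertex_excess D v > 0}"

definition U_minus :: "'a pair_pre_digraph \<Rightarrow> 'a set" where
  "U_minus D = {v \<in> pverts D. vertex_excess D v < 0}"

text \<open>
  A path is given by its list of arcs, so its edge set is \<open>set p\<close>. The parts of a partition are
  nonempty, hence the trivial path \<open>[]\<close> is excluded.
\<close>

definition perfect_decomposition ::
    "'a pair_pre_digraph \<Rightarrow> ('a \<times> 'a) awalk set \<Rightarrow> bool" where
  "perfect_decomposition D P \<longleftrightarrow>
     (\<forall>p\<in>P. p \<noteq> [] \<and> (\<exists>u v. pre_digraph.apath (with_proj D) u p v)) \<and>
     disjoint_family_on set P \<and>
     (\<Union>p\<in>P. set p) = parcs D \<and>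
     int (card P) = excess D"

text \<open>
  The functions \<open>f\<close> implicit in the hierarchy notation: \<open>a \<lless> b\<close> stands for \<open>a \<le> f b\<close> with such
  an \<open>f\<close>, one function for each occurrence of the symbol in a chain.
\<close>

definition hierarchy_fun :: "(real \<Rightarrow> real) \<Rightarrow> bool" where
  "hierarchy_fun f \<longleftrightarrow> f ` {0<..1} \<subseteq> {0<..1} \<and> mono_on {0<..1} f"

end

(*
  Suppose that |U^+| exceeds |U^-| by more than 2 * lam * n; the opposite case follows by reversing
  all arcs. Choose a small even set W of vertices of U^- whose excesses are at least C in absolute
  value and sum up to about half of the difference, and assign to each w in W as many private
  in-neighbours in U^+ as |ex(w)| prescribes. Let S be the set of the assigned vertices v and f(v)
  the vertex of W that v is assigned to. In D minus the arcs (v, f(v)) the vertices of W are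
  balanced, so the arcs meeting W split into paths v-w-v' and v-w-w'-v' with ends outside W.
  Greedily link these segments into edge-disjoint paths from U^+ to U^- - W which use up the whole
  excess of each v in S and leave some excess at every other vertex outside W. Deleting W and these
  paths yields D'. Each v in S has excess -1 in D', so exactly one path of a perfect decomposition
  of D' ends at v. Prolonging it by (v, f(v)), and adding the deleted paths, would give a perfect
  decomposition of D. To keep ex(D') large, S avoids the lam * n / 4 vertices of largest excess.
*)

theory Submission
  imports Defs
begin

text \<open>A vertex of S leaves U^+ and enters U^-, so the gap between the two classes shrinks by
  2|S|; as |S| is the sum of the |ex(w)| over W, that sum should be near half of the gap. The lower
  bound C on these excesses gives |W| <= n/C <= beta * n, and the parity of |W| keeps |D'| even. The
  heads f(v) lie in W because W disappears: a path of D' can be prolonged by (v, f(v)) without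
  meeting a vertex or an arc twice.

  The obstacle is the linking. Up to alpha * n^2 edge-disjoint paths are needed, so a vertex is
  visited many times. A connection with at most two inner vertices exists as long as the used arcs
  have in- and out-degree at most 3 * eps * n outside W. The greedy choice therefore avoids vertices
  with many visits, and a double count of all visits shows that these are few. A second danger is
  that every path already runs through the next segment; 5n additional paths, started at the
  reserved vertices of large excess, exclude this.\<close>

section \<open>Arc sets and vertex lists\<close>

text \<open>Paths are handled as vertex lists, so that simplicity is \<open>distinct\<close>,
  reversal is \<open>rev\<close> and linking is \<open>@\<close>. A one-vertex list has no arcs and
  is the initial state of a path that is still to be grown.\<close>

definition arcs_of :: "'a list \<Rightarrow> ('a \<times> 'a) set" where
  "arcs_of xs = set (zip xs (tl xs))"

lemma arcs_of_simps [simp]: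
  "arcs_of [] = {}" "arcs_of [x] = {}"
  "arcs_of (x # y # ys) = insert (x, y) (arcs_of (y # ys))"
  by (auto simp: arcs_of_def)

lemma finite_arcs_of [simp]: "finite (arcs_of xs)"
  by (simp add: arcs_of_def)

lemma arcs_of_append:
  assumes "xs \<noteq> []" "ys \<noteq> []"
  shows "arcs_of (xs @ ys) = insert (last xs, hd ys) (arcs_of xs \<union> arcs_of ys)"
  using assms
proof (induction xs rule: induct_list012)
  case (2 x)
  then show ?case by (cases ys) auto
qed auto

lemma arcs_of_verts: "(a, b) \<in> arcs_of xs \<Longrightarrow> a \<in> set xs \<and> b \<in> set xs"
  by (induction xs rule: induct_list012) auto

lemma arcs_of_rev: "arcs_of (rev xs) = (arcs_of xs)\<inverse>"
proof (induction xs rule: induct_list012)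
  case (3 x y zs)
  have "arcs_of (rev (y # zs) @ [x]) = insert (last (rev (y # zs)), x) (arcs_of (rev (y # zs)))"
    by (subst arcs_of_append) auto
  then show ?case using 3 by (auto simp: last_rev)
qed auto

lemma vertex_in_arc:
  assumes "z \<in> set xs" "length xs \<ge> 2"
  shows "\<exists>a\<in>arcs_of xs. fst a = z \<or> snd a = z"
  using assms
proof (induction xs rule: induct_list012)
  case (3 x y zs)
  then show ?case by (cases zs) fastforce+
qed auto

lemma arcs_of_out_unique:
  "distinct xs \<Longrightarrow> (z, b) \<in> arcs_of xs \<Longrightarrow> (z, c) \<in> arcs_of xs \<Longrightarrow> b = c"
  by (induction xs rule: induct_list012) (auto dest: arcs_of_verts)

lemma arcs_of_in_unique:
  assumes "distinct xs" "(b, z) \<in> arcs_of xs" "(c, z) \<in> arcs_of xs"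
  shows "b = c"
  using arcs_of_out_unique[of "rev xs" z b c] assms by (simp add: arcs_of_rev)

section \<open>Degrees and excesses of arc sets\<close>

definition out_deg :: "('a \<times> 'a) set \<Rightarrow> 'a \<Rightarrow> nat" where
  "out_deg E v = card {a \<in> E. fst a = v}"

definition in_deg :: "('a \<times> 'a) set \<Rightarrow> 'a \<Rightarrow> nat" where
  "in_deg E v = card {a \<in> E. snd a = v}"

text \<open>With an arc set as its only digraph argument, the excess is additive over disjoint arc
  sets, so deleted paths can be subtracted without fixing a vertex set.\<close>

definition exc :: "('a \<times> 'a) set \<Rightarrow> 'a \<Rightarrow> int" where
  "exc E v = int (out_deg E v) - int (in_deg E v)"

lemma out_deg_converse: "out_deg (E\<inverse>) v = in_deg E v"
proof -
  have "{a \<in> E\<inverse>. fst a = v} = prod.swap ` {a \<in> E. snd a = v}" by auto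
  then show ?thesis by (simp add: out_deg_def in_deg_def card_image)
qed

lemma in_deg_converse: "in_deg (E\<inverse>) v = out_deg E v"
  using out_deg_converse[of "E\<inverse>" v] by simp

lemma exc_converse: "exc (E\<inverse>) v = - exc E v"
  by (simp add: exc_def out_deg_converse in_deg_converse)

lemma out_deg_Un:
  "finite A \<Longrightarrow> finite B \<Longrightarrow> A \<inter> B = {} \<Longrightarrow> out_deg (A \<union> B) v = out_deg A v + out_deg B v"
  unfolding out_deg_def by (subst card_Un_disjoint [symmetric]) (auto intro: arg_cong[where f=card])

lemma in_deg_Un:
  "finite A \<Longrightarrow> finite B \<Longrightarrow> A \<inter> B = {} \<Longrightarrow> in_deg (A \<union> B) v = in_deg A v + in_deg B v"
  unfolding in_deg_def by (subst card_Un_disjoint [symmetric]) (auto intro: arg_cong[where f=card])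

lemma exc_Un: "finite A \<Longrightarrow> finite B \<Longrightarrow> A \<inter> B = {} \<Longrightarrow> exc (A \<union> B) v = exc A v + exc B v"
  by (simp add: exc_def out_deg_Un in_deg_Un)

lemma exc_Diff: "finite A \<Longrightarrow> B \<subseteq> A \<Longrightarrow> exc (A - B) v = exc A v - exc B v"
proof -
  assume "finite A" "B \<subseteq> A"
  then have "exc (A - B \<union> B) v = exc (A - B) v + exc B v"
    by (intro exc_Un) (auto intro: finite_subset)
  moreover have "A - B \<union> B = A" using \<open>B \<subseteq> A\<close> by auto
  ultimately show ?thesis by simp
qed

lemma exc_empty [simp]: "exc {} v = 0"
  by (simp add: exc_def out_deg_def in_deg_def)

lemma exc_UN:
  assumes "finite I" "\<And>i. i \<in> I \<Longrightarrow> finite (A i)" "disjoint_family_on A I"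
  shows "exc (\<Union>i\<in>I. A i) v = (\<Sum>i\<in>I. exc (A i) v)"
  using assms
proof (induction I rule: finite_induct)
  case (insert i I)
  have "A i \<inter> (\<Union>j\<in>I. A j) = {}"
    using insert.prems insert.hyps by (auto simp: disjoint_family_on_def)
  then show ?case
    using insert by (simp add: exc_Un disjoint_family_on_def)
qed simp

lemma exc_singleton: "exc {(a, b)} v = of_bool (v = a) - of_bool (v = b)"
proof -
  have "{x \<in> {(a, b)}. fst x = v} = (if v = a then {(a, b)} else {})"
    "{x \<in> {(a, b)}. snd x = v} = (if v = b then {(a, b)} else {})" by auto
  then show ?thesis by (simp add: exc_def out_deg_def in_deg_def)
qed

lemma exc_arcs_of:
  "distinct xs \<Longrightarrow> xs \<noteq> [] \<Longrightarrow> exc (arcs_of xs) v = of_bool (v = hd xs) - of_bool (v = last xs)"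
proof (induction xs rule: induct_list012)
  case (3 x y zs)
  have "exc (arcs_of (x # y # zs)) v = exc ({(x, y)} \<union> arcs_of (y # zs)) v" by simp
  also have "\<dots> = exc {(x, y)} v + exc (arcs_of (y # zs)) v"
    using 3 by (intro exc_Un) (auto dest: arcs_of_verts)
  finally show ?case using 3 by (simp add: exc_singleton)
qed auto

text \<open>Both degree sums count the arcs.\<close>

lemma sum_exc:
  assumes "finite V" "E \<subseteq> V \<times> V"
  shows "(\<Sum>v\<in>V. exc E v) = 0"
proof -
  have fE: "finite E" using assms finite_subset by blast
  have "(\<Sum>v\<in>V. card {a \<in> E. fst a = v}) = card (\<Union>v\<in>V. {a \<in> E. fst a = v})"
    using assms fE by (subst card_UN_disjoint) auto
  also have "(\<Union>v\<in>V. {a \<in> E. fst a = v}) = E" using assms by fastforce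
  finally have 1: "(\<Sum>v\<in>V. out_deg E v) = card E" by (simp add: out_deg_def)
  have "(\<Sum>v\<in>V. card {a \<in> E. snd a = v}) = card (\<Union>v\<in>V. {a \<in> E. snd a = v})"
    using assms fE by (subst card_UN_disjoint) auto
  also have "(\<Union>v\<in>V. {a \<in> E. snd a = v}) = E" using assms by fastforce
  finally have 2: "(\<Sum>v\<in>V. in_deg E v) = card E" by (simp add: in_deg_def)
  show ?thesis using 1 2
    by (simp add: exc_def sum_subtractf flip: of_nat_sum)
qed

definition total_exc :: "'a set \<Rightarrow> ('a \<times> 'a) set \<Rightarrow> int" where
  "total_exc V E = (\<Sum>v\<in>V. max (exc E v) 0)"

text \<open>The identity max x 0 - max (-x) 0 = x turns the difference of the two totals into the
  sum of all excesses, which is 0.\<close>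

lemma total_exc_converse:
  assumes "finite V" "E \<subseteq> V \<times> V"
  shows "total_exc V (E\<inverse>) = total_exc V E"
proof -
  have "total_exc V E - total_exc V (E\<inverse>) = (\<Sum>v\<in>V. exc E v)"
    unfolding total_exc_def sum_subtractf [symmetric]
    by (intro sum.cong) (auto simp: exc_converse max_def)
  then show ?thesis using sum_exc[OF assms] by simp
qed

lemma total_exc_negative:
  assumes "finite V" "E \<subseteq> V \<times> V"
  shows "total_exc V E = (\<Sum>v\<in>V. max (- exc E v) 0)"
  using total_exc_converse[OF assms] by (simp add: total_exc_def exc_converse)

text \<open>The counterpart of \<open>perfect_decomposition\<close> for vertex lists; a path with an
  arc has at least two vertices. Finiteness is explicit because \<open>card\<close> of an infinite
  set is 0.\<close>

definition perfect_paths :: "'a set \<Rightarrow> ('a \<times> 'a) set \<Rightarrow> 'a list set \<Rightarrow> bool" where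
  "perfect_paths V E P \<longleftrightarrow> finite P \<and> (\<forall>xs\<in>P. distinct xs \<and> length xs \<ge> 2) \<and>
     disjoint_family_on arcs_of P \<and> (\<Union>xs\<in>P. arcs_of xs) = E \<and> int (card P) = total_exc V E"

lemma perfect_paths_converse:
  assumes "finite V" "E \<subseteq> V \<times> V" "perfect_paths V E P"
  shows "perfect_paths V (E\<inverse>) (rev ` P)"
  unfolding perfect_paths_def
proof (intro conjI)
  show "finite (rev ` P)" "\<forall>xs\<in>rev ` P. distinct xs \<and> length xs \<ge> 2"
    using assms by (auto simp: perfect_paths_def)
  have "arcs_of xs \<inter> arcs_of ys = {}" if "xs \<in> P" "ys \<in> P" "xs \<noteq> ys" for xs ys
    using assms that by (auto simp: perfect_paths_def disjoint_family_on_def)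
  then show "disjoint_family_on arcs_of (rev ` P)"
    by (fastforce simp: disjoint_family_on_def arcs_of_rev)
  show "(\<Union>xs\<in>rev ` P. arcs_of xs) = E\<inverse>"
    using assms by (auto simp: perfect_paths_def arcs_of_rev)
  show "int (card (rev ` P)) = total_exc V (E\<inverse>)"
    using assms by (simp add: card_image total_exc_converse perfect_paths_def)
qed

text \<open>In a perfect decomposition no vertex is both the start of a path and the end of a path.\<close>

lemma perfect_paths_ends:
  assumes "finite V" "E \<subseteq> V \<times> V" "perfect_paths V E P" "v \<in> V"
  shows "int (card {xs \<in> P. last xs = v}) = max (- exc E v) 0"
proof -
  have fP: "finite P" and P: "\<And>xs. xs \<in> P \<Longrightarrow> distinct xs \<and> length xs \<ge> 2"
    and dj: "disjoint_family_on arcs_of P" and un: "(\<Union>xs\<in>P. arcs_of xs) = E"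
    and cP: "int (card P) = total_exc V E"
    using assms by (auto simp: perfect_paths_def)
  define a where "a v = int (card {xs \<in> P. hd xs = v})" for v
  define b where "b v = int (card {xs \<in> P. last xs = v})" for v
  have ex: "exc E v = a v - b v" for v
  proof -
    have "exc E v = (\<Sum>xs\<in>P. exc (arcs_of xs) v)"
      unfolding un [symmetric] using fP dj by (intro exc_UN) auto
    also have "\<dots> = (\<Sum>xs\<in>P. of_bool (hd xs = v) - of_bool (last xs = v))"
    proof (intro sum.cong refl)
      fix xs assume "xs \<in> P"
      then have "distinct xs" "xs \<noteq> []" using P by fastforce+
      then show "exc (arcs_of xs) v = of_bool (hd xs = v) - of_bool (last xs = v)"
        by (simp add: exc_arcs_of eq_commute)
    qed
    also have "\<dots> = a v - b v"
      by (simp add: sum_subtractf a_def b_def sum.If_cases fP Int_def of_bool_def)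
    finally show ?thesis .
  qed
  have hdV: "hd xs \<in> V" if "xs \<in> P" for xs
  proof -
    obtain x y zs where xs: "xs = x # y # zs"
      using P[OF \<open>xs \<in> P\<close>] by (cases xs; cases "tl xs") auto
    then have "(hd xs, y) \<in> E" using that un xs by force
    then show ?thesis using assms by auto
  qed
  \<comment> \<open>Each \<open>a v\<close> is at least \<open>max (exc E v) 0\<close>, and both sum
    to the number of paths, hence they agree at every vertex.\<close>
  have "(\<Sum>v\<in>V. a v) = int (card (\<Union>v\<in>V. {xs \<in> P. hd xs = v}))"
    unfolding a_def using fP assms(1) by (subst card_UN_disjoint) auto
  also have "(\<Union>v\<in>V. {xs \<in> P. hd xs = v}) = P" using hdV by auto
  finally have "(\<Sum>v\<in>V. a v) = (\<Sum>v\<in>V. max (exc E v) 0)"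
    using cP by (simp add: total_exc_def)
  then have "(\<Sum>v\<in>V. a v - max (exc E v) 0) = 0" by (simp add: sum_subtractf)
  moreover have "a v - max (exc E v) 0 \<ge> 0" for v
    using ex[of v] by (auto simp: a_def b_def)
  ultimately have "a v - max (exc E v) 0 = 0"
    using assms(1,4) by (simp add: sum_nonneg_eq_0_iff)
  then show ?thesis using ex[of v] by (auto simp: b_def)
qed

section \<open>Short connections and selection lemmas\<close>

text \<open>Averaging: without antiparallel arcs the arcs inside \<open>A\<close> and their
  reversals are disjoint subsets of A x A, so there are at most |A|^2 / 2 of them.\<close>

lemma ex_small_out_neighbourhood:
  assumes "finite A" "A \<noteq> {}" and anti: "\<And>a b. (a, b) \<in> E \<Longrightarrow> (b, a) \<notin> E"
  shows "\<exists>a\<in>A. 2 * card {b \<in> A. (a, b) \<in> E} \<le> card A"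
proof (rule ccontr)
  assume *: "\<not> ?thesis"
  define F where "F = E \<inter> A \<times> A"
  have fF: "finite F" using assms by (simp add: F_def)
  have "(\<Sum>a\<in>A. card {b \<in> A. (a, b) \<in> E}) = (\<Sum>a\<in>A. card {x \<in> F. fst x = a})"
  proof (intro sum.cong refl)
    fix a assume "a \<in> A"
    then have "{x \<in> F. fst x = a} = Pair a ` {b \<in> A. (a, b) \<in> E}"
      by (auto simp: F_def)
    then show "card {b \<in> A. (a, b) \<in> E} = card {x \<in> F. fst x = a}"
      by (simp add: card_image inj_on_def)
  qed
  also have "\<dots> = card (\<Union>a\<in>A. {x \<in> F. fst x = a})"
    using assms fF by (subst card_UN_disjoint) auto
  also have "(\<Union>a\<in>A. {x \<in> F. fst x = a}) = F" by (auto simp: F_def)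
  finally have 1: "(\<Sum>a\<in>A. card {b \<in> A. (a, b) \<in> E}) = card F" .
  have "card F + card (F\<inverse>) = card (F \<union> F\<inverse>)"
    using fF anti by (intro card_Un_disjoint [symmetric]) (auto simp: F_def)
  also have "\<dots> \<le> card (A \<times> A)"
    using assms by (intro card_mono) (auto simp: F_def)
  finally have 2: "2 * card F \<le> card A * card A" by (simp add: card_inverse card_cartesian_product)
  have "(\<Sum>a\<in>A. card A) < (\<Sum>a\<in>A. 2 * card {b \<in> A. (a, b) \<in> E})"
    using * assms by (intro sum_strict_mono) (auto simp: not_le)
  then show False using 1 2 by (simp flip: sum_distrib_left)
qed

lemma out_deg_alt: "out_deg E v = card {b. (v, b) \<in> E}"
proof -
  have "{a \<in> E. fst a = v} = Pair v ` {b. (v, b) \<in> E}" by auto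
  then show ?thesis by (simp add: out_deg_def card_image inj_on_def)
qed

lemma in_deg_alt: "in_deg E v = card {b. (b, v) \<in> E}"
proof -
  have "{a \<in> E. snd a = v} = (\<lambda>b. (b, v)) ` {b. (b, v) \<in> E}" by auto
  then show ?thesis by (simp add: in_deg_def card_image inj_on_def)
qed

text \<open>
  The out-neighbourhood \<open>A\<close> of \<open>x\<close> and the in-neighbourhood \<open>B\<close> of \<open>u\<close> both contain almost half
  of the vertices. If they are disjoint, then some \<open>a \<in> A\<close> has at most half of \<open>A\<close> as
  out-neighbours, so about a quarter of all vertices are out-neighbours of \<open>a\<close> in \<open>B\<close>.
\<close>

lemma short_connection:
  fixes \<epsilon> :: real and V :: "'a set"
  assumes V: "finite V" "card V = n" and E: "E \<subseteq> V \<times> V"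
    and anti: "\<And>a b. (a, b) \<in> E \<Longrightarrow> (b, a) \<notin> E"
    and out: "\<And>v. v \<in> V \<Longrightarrow> real (out_deg E v) \<ge> (1/2 - \<epsilon>) * n"
    and inn: "\<And>v. v \<in> V \<Longrightarrow> real (in_deg E v) \<ge> (1/2 - \<epsilon>) * n"
    and U: "finite U" "\<And>v. v \<in> V - X \<Longrightarrow> real (out_deg U v) \<le> 3 * \<epsilon> * n"
      "\<And>v. v \<in> V - X \<Longrightarrow> real (in_deg U v) \<le> 3 * \<epsilon> * n"
      "real (out_deg U x) \<le> 3 * \<epsilon> * n" "real (in_deg U u) \<le> 3 * \<epsilon> * n"
    and X: "finite X" "real (card X) \<le> 3 * \<epsilon> * n"
    and xu: "x \<in> V" "u \<in> V" and eps: "0 < \<epsilon>" "\<epsilon> \<le> 1 / 1000" "\<epsilon> * n \<ge> 2"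
  shows "\<exists>ys. ys \<noteq> [] \<and> length ys \<le> 2 \<and> distinct ys \<and> set ys \<subseteq> V - X - {x, u} \<and>
    arcs_of (x # ys @ [u]) \<subseteq> E - U"
proof (rule ccontr)
  assume no: "\<not> ?thesis"
  define A where "A = {a \<in> V - X - {x, u}. (x, a) \<in> E - U}"
  define B where "B = {b \<in> V - X - {x, u}. (b, u) \<in> E - U}"
  have fin: "finite A" "finite B" using V by (auto simp: A_def B_def)
  have fU: "finite {b. (v, b) \<in> U}" "finite {b. (b, v) \<in> U}" for v
    using finite_subset[of "{b. (v, b) \<in> U}" "snd ` U"] finite_subset[of "{b. (b, v) \<in> U}" "fst ` U"]
      U(1) by force+
  have two: "card {x, u} \<le> 2" by (simp add: card_insert_if)
  \<comment> \<open>The loss of 8 * eps * n is 1 from the degree bound, 3 from the arcs in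
    \<open>U\<close>, 3 from \<open>X\<close>, and 1 for the two vertices x and u.\<close>
  have "out_deg E x \<le> card (A \<union> {b. (x, b) \<in> U} \<union> X \<union> {x, u})"
    unfolding out_deg_alt using E X fin fU by (intro card_mono) (auto simp: A_def)
  also have "\<dots> \<le> card A + out_deg U x + card X + 2"
    unfolding out_deg_alt
    by (rule order_trans[OF card_Un_le] add_mono two order_refl)+
  finally have cA: "real (card A) \<ge> (1/2 - 8 * \<epsilon>) * n"
    using out[OF xu(1)] U(4) X(2) eps(3) by (simp add: algebra_simps)
  have "in_deg E u \<le> card (B \<union> {b. (b, u) \<in> U} \<union> X \<union> {x, u})"
    unfolding in_deg_alt using E X fin fU by (intro card_mono) (auto simp: B_def)
  also have "\<dots> \<le> card B + in_deg U u + card X + 2"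
    unfolding in_deg_alt
    by (rule order_trans[OF card_Un_le] add_mono two order_refl)+
  finally have cB: "real (card B) \<ge> (1/2 - 8 * \<epsilon>) * n"
    using inn[OF xu(2)] U(5) X(2) eps(3) by (simp add: algebra_simps)
  have disj: "A \<inter> B = {}"
  proof (rule ccontr)
    assume "A \<inter> B \<noteq> {}"
    then obtain a where "a \<in> A" "a \<in> B" by auto
    then show False using no by (auto simp: A_def B_def dest!: spec[of _ "[a]"])
  qed
  have npos: "real n > 0" using eps by (cases "n = 0") auto
  have "(1/2 - 8 * \<epsilon>) * n > 0" using npos eps by simp
  then have "A \<noteq> {}" using cA by auto
  then obtain a where a: "a \<in> A" "2 * card {b \<in> A. (a, b) \<in> E} \<le> card A"
    using ex_small_out_neighbourhood[OF fin(1) _ anti] by blast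
  have noarc: "(a, b) \<notin> E - U" if "b \<in> B" for b
  proof
    assume "(a, b) \<in> E - U"
    moreover have "a \<noteq> b" using that disj a by auto
    ultimately show False
      using no a that by (auto simp: A_def B_def dest!: spec[of _ "[a, b]"])
  qed
  have aV: "a \<in> V - X" using a by (auto simp: A_def)
  have "out_deg E a \<le> card ({b \<in> A. (a, b) \<in> E} \<union> (V - A - B) \<union> {b. (a, b) \<in> U})"
    unfolding out_deg_alt using E V fin fU noarc by (intro card_mono) auto
  also have "\<dots> \<le> card {b \<in> A. (a, b) \<in> E} + card (V - A - B) + out_deg U a"
    unfolding out_deg_alt
    by (rule order_trans[OF card_Un_le] add_mono two order_refl)+
  finally have 1: "real (out_deg E a) \<le> card {b \<in> A. (a, b) \<in> E} + card (V - A - B) + out_deg U a"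
    by linarith
  have "A \<subseteq> V" by (auto simp: A_def)
  moreover have "B \<subseteq> V" by (auto simp: B_def)
  ultimately have "A \<subseteq> V" "B \<subseteq> V - A" using disj by blast+
  then have "card V = card A + card B + card (V - A - B)"
    using V fin card_Diff_subset[of A V] card_Diff_subset[of B "V - A"]
      card_mono[of V A] card_mono[of "V - A" B] by auto
  then have 2: "real n = card A + card B + card (V - A - B)" using V by simp
  have "real (2 * card {b \<in> A. (a, b) \<in> E}) \<le> real (card A)" using a(2) by (rule of_nat_mono)
  then have "(1/2 - \<epsilon>) * n \<le> real n - card A / 2 - card B + 3 * \<epsilon> * n"
    using 1 2 out[of a] U(2)[OF aV] aV by simp
  \<comment> \<open>The 16 is 1 (degree of a) + 4 (half of the 8 for A) + 8 (for B) + 3 (arcs in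
    \<open>U\<close>).\<close>
  then have "n / 4 \<le> 16 * (\<epsilon> * n)" using cA cB by (simp add: algebra_simps)
  moreover have "\<epsilon> * n \<le> 1 / 1000 * n" using eps by (intro mult_right_mono) auto
  ultimately show False using npos by simp
qed

text \<open>Dropping an element of smallest value does not lower the average. The inequality says
  that the average over \<open>R\<close> is at least that over \<open>U\<close>, with denominators
  cleared.\<close>

lemma ex_large_subset_sum:
  fixes f :: "'a \<Rightarrow> nat"
  assumes "finite U" "k \<le> card U"
  shows "\<exists>R\<subseteq>U. card R = k \<and> k * sum f U \<le> card U * sum f R"
  using assms(2)
proof (induction k rule: inc_induct)
  case base
  then show ?case by (intro exI[of _ U]) auto
next
  case (step k)
  then obtain R where R: "R \<subseteq> U" "card R = Suc k" "Suc k * sum f U \<le> card U * sum f R" by blast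
  have fR: "finite R" using R assms finite_subset by blast
  then have "Min (f ` R) \<in> f ` R" using R by (intro Min_in) auto
  then obtain r where r: "r \<in> R" "f r = Min (f ` R)" by auto
  have "Suc k * f r = (\<Sum>x\<in>R. f r)" using R by simp
  also have "\<dots> \<le> sum f R" using r fR by (intro sum_mono) auto
  finally have "Suc k * f r \<le> sum f R" .
  then have *: "k * sum f R \<le> Suc k * sum f (R - {r})"
    using fR r by (simp add: sum_diff1_nat algebra_simps)
  have "Suc k * (k * sum f U) \<le> k * (card U * sum f R)"
    using mult_left_mono[OF R(3), of k] by (simp add: algebra_simps)
  also have "\<dots> \<le> Suc k * (card U * sum f (R - {r}))"
    using mult_left_mono[OF *, of "card U"] by (simp add: algebra_simps)
  finally have "k * sum f U \<le> card U * sum f (R - {r})"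
    using mult_le_cancel1[of "Suc k"] by blast
  then show ?case using R r fR by (intro exI[of _ "R - {r}"]) auto
qed

text \<open>Greedy filling up to the caps. It distributes a given number of path ends over vertices
  that must keep some excess.\<close>

lemma ex_bounded_function_with_sum:
  fixes f :: "'a \<Rightarrow> nat"
  assumes "finite V" "m \<le> sum f V"
  shows "\<exists>g. (\<forall>v. g v \<le> f v) \<and> (\<forall>v. v \<notin> V \<longrightarrow> g v = 0) \<and> sum g V = m"
  using assms
proof (induction V arbitrary: m rule: finite_induct)
  case (insert x V)
  then have "m - min m (f x) \<le> sum f V" by auto
  then obtain g where g: "\<forall>v. g v \<le> f v" "\<forall>v. v \<notin> V \<longrightarrow> g v = 0" "sum g V = m - min m (f x)"
    using insert.IH by blast
  have "sum (g(x := min m (f x))) V = sum g V"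
    using insert.hyps by (intro sum.cong) auto
  then show ?case using g insert.hyps
    by (intro exI[of _ "g(x := min m (f x))"]) auto
qed (auto intro: exI[of _ "\<lambda>_. 0"])

text \<open>Number the disjoint union of \<open>b v\<close> copies of each vertex v. This turns
  multiplicities into the sequences of starts and ends of the linked paths.\<close>

lemma ex_function_with_fibre_sizes:
  fixes b :: "'a \<Rightarrow> nat"
  assumes "finite V" "sum b V = N" "\<And>v. v \<notin> V \<Longrightarrow> b v = 0"
  shows "\<exists>r. (\<forall>i<N. r i \<in> V) \<and> (\<forall>v. card {i. i < N \<and> r i = v} = b v)"
proof -
  define T where "T = (SIGMA v:V. {..<b v})"
  have "card T = N" "finite T" using assms by (auto simp: T_def card_SigmaI)
  then obtain h where h: "bij_betw h {..<N} T"
    using finite_same_card_bij[of "{..<N}" T] by auto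
  have "card {i. i < N \<and> fst (h i) = v} = b v" for v
  proof -
    have "bij_betw h {i. i < N \<and> fst (h i) = v} {t \<in> T. fst t = v}"
      using h by (auto simp: bij_betw_def inj_on_def)
    then have "card {i. i < N \<and> fst (h i) = v} = card {t \<in> T. fst t = v}"
      by (rule bij_betw_same_card)
    also have "{t \<in> T. fst t = v} = Pair v ` {..<b v}"
      using assms(3)[of v] by (cases "v \<in> V") (auto simp: T_def)
    finally show ?thesis by (simp add: card_image inj_on_def)
  qed
  moreover have "fst (h i) \<in> V" if "i < N" for i
    using bij_betw_apply[OF h, of i] that by (auto simp: T_def)
  ultimately show ?thesis by (intro exI[of _ "fst \<circ> h"]) auto
qed

text \<open>A greedy choice suffices, since each candidate set alone is as large as the total
  demand.\<close>

lemma ex_disjoint_representatives: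
  fixes d :: "'b \<Rightarrow> nat"
  assumes "finite W" "\<And>w. w \<in> W \<Longrightarrow> finite (N w) \<and> sum d W \<le> card (N w)"
  shows "\<exists>T. (\<forall>w\<in>W. T w \<subseteq> N w \<and> card (T w) = d w) \<and> disjoint_family_on T W"
  using assms
proof (induction W rule: finite_induct)
  case (insert x W)
  have "sum d W \<le> sum d (insert x W)" using insert.hyps by simp
  then obtain T where T: "\<forall>w\<in>W. T w \<subseteq> N w \<and> card (T w) = d w" "disjoint_family_on T W"
    using insert.IH insert.prems by (meson insertI2 order_trans)
  have fT: "finite (\<Union>w\<in>W. T w)" 
    using T(1) insert.prems insert.hyps(1) by (intro finite_UN_I) (auto intro: finite_subset)
  have "card (\<Union>w\<in>W. T w) \<le> sum d W"
    using card_UN_le[OF insert.hyps(1), of T] T by simp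
  then have "d x \<le> card (N x) - card (\<Union>w\<in>W. T w)"
    using insert.prems[of x] insert.hyps by simp linarith
  also have "\<dots> \<le> card (N x - (\<Union>w\<in>W. T w))"
    using fT by (intro diff_card_le_card_Diff)
  finally obtain Y where Y: "Y \<subseteq> N x - (\<Union>w\<in>W. T w)" "card Y = d x"
    by (meson obtain_subset_with_card_n)
  have "disjoint_family_on (T(x := Y)) (insert x W)"
    using T(2) Y insert.hyps by (auto simp: disjoint_family_on_def)
  moreover have "\<forall>w\<in>insert x W. (T(x := Y)) w \<subseteq> N w \<and> card ((T(x := Y)) w) = d w"
    using T Y insert.hyps by auto
  ultimately show ?case by (intro exI[of _ "T(x := Y)"] conjI)
qed (auto simp: disjoint_family_on_def)

text \<open>Disjoint sets have distinct chosen points in \<open>B\<close>. It bounds the number of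
  segments through a vertex by a number of arcs there.\<close>

lemma card_family_hitting:
  assumes "finite B" "disjoint_family_on A I" "\<And>i. i \<in> I \<Longrightarrow> A i \<inter> B \<noteq> {}"
  shows "card I \<le> card B"
proof -
  have "\<forall>i\<in>I. \<exists>b. b \<in> A i \<inter> B" using assms(3) by blast
  then obtain h where h: "\<forall>i\<in>I. h i \<in> A i \<inter> B" by metis
  then have "inj_on h I" using assms(2) by (fastforce simp: inj_on_def disjoint_family_on_def)
  moreover have "h ` I \<subseteq> B" using h by auto
  ultimately show ?thesis using card_inj_on_le assms(1) by blast
qed

section \<open>Segments through a balanced set\<close>

text \<open>Segments are split off one at a time. They begin and end outside \<open>W\<close>, so
  \<open>W\<close> stays balanced. Arcs inside \<open>W\<close> go first, each as the middle arc of
  a segment v-w-w'-v'; then balance pairs the remaining in-arcs and out-arcs as v-w-v'. The degree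
  comparison is conditional on inner arcs at w, since the second phase uses up the outer
  arcs.\<close>

lemma ex_segments:
  assumes "finite H" and "\<And>a b. (a, b) \<in> H \<Longrightarrow> (b, a) \<notin> H"
    and "\<And>w. w \<in> W \<Longrightarrow> exc H w = 0"
    and "\<And>w. w \<in> W \<Longrightarrow> {a \<in> H \<inter> W \<times> W. fst a = w \<or> snd a = w} \<noteq> {} \<Longrightarrow>
      card {a \<in> H \<inter> W \<times> W. fst a = w \<or> snd a = w} < card {a \<in> H. fst a = w \<and> snd a \<notin> W} \<and>
      card {a \<in> H \<inter> W \<times> W. fst a = w \<or> snd a = w} < card {a \<in> H. snd a = w \<and> fst a \<notin> W}"
  shows "\<exists>S. finite S \<and> (\<forall>xs\<in>S. distinct xs \<and> 3 \<le> length xs \<and> length xs \<le> 4 \<and>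
      hd xs \<notin> W \<and> last xs \<notin> W \<and> set xs \<inter> W \<noteq> {}) \<and> disjoint_family_on arcs_of S \<and>
    (\<Union>xs\<in>S. arcs_of xs) = {a \<in> H. fst a \<in> W \<or> snd a \<in> W}"
  using assms
proof (induction "card H" arbitrary: H rule: less_induct)
  case less
  let ?inner = "\<lambda>H w. {a \<in> H \<inter> W \<times> W. fst a = w \<or> snd a = w}"
  let ?out = "\<lambda>H w. {a \<in> H. fst a = w \<and> snd a \<notin> W}"
  let ?in = "\<lambda>H w. {a \<in> H. snd a = w \<and> fst a \<notin> W}"
  note fin = less.prems(1) and anti = less.prems(2) and bal = less.prems(3) and inner = less.prems(4)
  have loopfree: "(a, a) \<notin> H" for a using anti[of a a] by auto
  have step: ?case
    if xs: "distinct xs" "3 \<le> length xs" "length xs \<le> 4" "hd xs \<notin> W" "last xs \<notin> W"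
      "set xs \<inter> W \<noteq> {}" "arcs_of xs \<subseteq> {a \<in> H. fst a \<in> W \<or> snd a \<in> W}"
      and inner': "\<And>w. w \<in> W \<Longrightarrow> ?inner (H - arcs_of xs) w \<noteq> {} \<Longrightarrow>
        card (?inner (H - arcs_of xs) w) < card (?out (H - arcs_of xs) w) \<and>
        card (?inner (H - arcs_of xs) w) < card (?in (H - arcs_of xs) w)" for xs
  proof -
    let ?H = "H - arcs_of xs"
    have ne: "arcs_of xs \<noteq> {}"
      using xs(2) by (cases xs; cases "tl xs") auto
    have "card ?H < card H"
      using fin xs(7) ne by (intro psubset_card_mono) auto
    moreover have "exc ?H w = 0" if "w \<in> W" for w
    proof -
      have "exc ?H w = exc H w - exc (arcs_of xs) w" using fin xs by (intro exc_Diff) auto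
      moreover have "exc (arcs_of xs) w = 0"
        using xs that by (subst exc_arcs_of) auto
      ultimately show ?thesis using bal[OF that] by simp
    qed
    ultimately have "\<exists>S. finite S \<and> (\<forall>xs\<in>S. distinct xs \<and> 3 \<le> length xs \<and> length xs \<le> 4 \<and>
      hd xs \<notin> W \<and> last xs \<notin> W \<and> set xs \<inter> W \<noteq> {}) \<and> disjoint_family_on arcs_of S \<and>
      (\<Union>xs\<in>S. arcs_of xs) = {a \<in> ?H. fst a \<in> W \<or> snd a \<in> W}"
      using fin anti inner' by (intro less.hyps[of ?H]) (assumption | simp)+
    then obtain S where S: "finite S" "\<forall>xs\<in>S. distinct xs \<and> 3 \<le> length xs \<and> length xs \<le> 4 \<and>
      hd xs \<notin> W \<and> last xs \<notin> W \<and> set xs \<inter> W \<noteq> {}" "disjoint_family_on arcs_of S"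
      "(\<Union>xs\<in>S. arcs_of xs) = {a \<in> ?H. fst a \<in> W \<or> snd a \<in> W}"
      by (elim exE conjE)
    have "disjoint_family_on arcs_of (insert xs S)"
      using S(3,4) by (auto simp: disjoint_family_on_def)
    moreover have "(\<Union>xs\<in>insert xs S. arcs_of xs) = {a \<in> H. fst a \<in> W \<or> snd a \<in> W}"
      using S(4) xs(7) by auto
    ultimately show ?thesis
      using S(1,2) xs by (intro exI[of _ "insert xs S"] conjI) simp_all
  qed
  show ?case
  proof (cases "H \<inter> W \<times> W = {}")
    case False
    then obtain w w' where w: "(w, w') \<in> H" "w \<in> W" "w' \<in> W" by auto
    have "w \<noteq> w'" using w loopfree by auto
    have fI: "finite (?inner H z)" "finite (?out H z)" "finite (?in H z)" for z using fin by auto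
    have I: "(w, w') \<in> ?inner H w" "(w, w') \<in> ?inner H w'" using w by auto
    then have c1: "card (?inner H w) \<ge> 1" "card (?inner H w') \<ge> 1"
      using fI by (auto simp: Suc_le_eq card_gt_0_iff)
    have "?inner H w \<noteq> {}" using I(1) by blast
    then have "card (?in H w) \<noteq> 0" using inner[OF w(2)] by linarith
    then have "?in H w \<noteq> {}" by (metis card.empty)
    then obtain v where v: "(v, w) \<in> H" "v \<notin> W" by auto
    have "?inner H w' \<noteq> {}" using I(2) by blast
    \<comment> \<open>Two outer out-neighbours of w' are needed, so that one of them differs from v
      and the segment is a path.\<close>
    then have "card (?out H w') \<ge> 2" using inner[OF w(3)] c1 by linarith
    moreover have "card (?out H w') - card {(w', v)} \<le> card (?out H w' - {(w', v)})"
      by (rule diff_card_le_card_Diff) simp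
    ultimately have "card (?out H w' - {(w', v)}) \<noteq> 0" by simp
    then have "?out H w' - {(w', v)} \<noteq> {}" by (metis card.empty)
    then obtain a where "a \<in> ?out H w' - {(w', v)}" by blast
    then obtain v' where v': "(w', v') \<in> H" "v' \<notin> W" "v' \<noteq> v" by (cases a) auto
    let ?xs = "[v, w, w', v']"
    have arcs: "arcs_of ?xs = {(v, w), (w, w'), (w', v')}" by auto
    show ?thesis
    proof (rule step[of ?xs])
      fix z assume z: "z \<in> W" "?inner (H - arcs_of ?xs) z \<noteq> {}"
      have i: "?inner (H - arcs_of ?xs) z = ?inner H z - {(w, w')}"
        using v v' by (auto simp: arcs)
      have o: "?out (H - arcs_of ?xs) z = ?out H z - {(w', v')}"
        using w by (auto simp: arcs)
      have n: "?in (H - arcs_of ?xs) z = ?in H z - {(v, w)}"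
        using w by (auto simp: arcs)
      have "?inner H z \<noteq> {}" using z(2) unfolding i by blast
      then have lt: "card (?inner H z) < card (?out H z)" "card (?inner H z) < card (?in H z)"
        using inner[OF z(1)] by auto
      have ne: "card (?inner H z) \<ge> 1" using \<open>?inner H z \<noteq> {}\<close> fI(1)[of z]
        by (simp add: Suc_le_eq card_gt_0_iff)
      show "card (?inner (H - arcs_of ?xs) z) < card (?out (H - arcs_of ?xs) z) \<and>
        card (?inner (H - arcs_of ?xs) z) < card (?in (H - arcs_of ?xs) z)"
      proof (cases "z = w \<or> z = w'")
        \<comment> \<open>At w and w' the inner count drops by exactly one and each outer count by
          at most one, so the strict inequalities survive.\<close>
        case True
        then have "card (?inner (H - arcs_of ?xs) z) = card (?inner H z) - 1"
          unfolding i using I by (intro card_Diff_singleton) auto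
        moreover have "card (?out (H - arcs_of ?xs) z) \<ge> card (?out H z) - 1"
          "card (?in (H - arcs_of ?xs) z) \<ge> card (?in H z) - 1"
          unfolding o n by (simp_all add: card_Diff_singleton_if)
        ultimately show ?thesis using lt ne by linarith
      next
        case False
        then have "?inner H z - {(w, w')} = ?inner H z" "?out H z - {(w', v')} = ?out H z"
          "?in H z - {(v, w)} = ?in H z" by auto
        then show ?thesis unfolding i o n using lt by simp
      qed
    qed (use w v v' \<open>w \<noteq> w'\<close> in \<open>auto simp: insert_commute\<close>)
  next
    case no_inner: True
    show ?thesis
    proof (cases "{a \<in> H. fst a \<in> W \<or> snd a \<in> W} = {}")
      case True
      then show ?thesis by (intro exI[of _ "{}"]) (auto simp: disjoint_family_on_def)
    next
      case False
      then obtain w where w: "w \<in> W" "out_deg H w > 0 \<or> in_deg H w > 0"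
        using fin by (fastforce simp: out_deg_def in_deg_def card_gt_0_iff)
      then have "out_deg H w > 0" "in_deg H w > 0" using bal[OF w(1)] by (auto simp: exc_def)
      then obtain v v' where v: "(v, w) \<in> H" "(w, v') \<in> H"
        by (fastforce simp: out_deg_def in_deg_def card_gt_0_iff)
      then have "v \<notin> W" "v' \<notin> W" "v \<noteq> v'" using no_inner w anti by auto
      then show ?thesis
        using v w no_inner by (intro step[of "[v, w, v']"]) auto
    qed
  qed
qed

text \<open>The middle set contains both arcs by which the connection \<open>ys\<close> is attached;
  it is the arc set that \<open>short_connection\<close> controls.\<close>

lemma arcs_of_append_connection:
  assumes "xs \<noteq> []" "zs \<noteq> []"
  shows "arcs_of (xs @ ys @ zs) = arcs_of xs \<union> arcs_of (last xs # ys @ [hd zs]) \<union> arcs_of zs"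
proof -
  have "arcs_of (xs @ ys @ zs) = insert (last xs, hd (ys @ zs)) (arcs_of xs \<union> arcs_of (ys @ zs))"
    using assms by (intro arcs_of_append) auto
  moreover have "arcs_of (last xs # ys @ [hd zs]) = insert (last xs, hd (ys @ zs)) (arcs_of (ys @ [hd zs]))"
    using assms arcs_of_append[of "[last xs]" "ys @ [hd zs]"] by (cases ys) auto
  moreover have "arcs_of (ys @ zs) = arcs_of (ys @ [hd zs]) \<union> arcs_of zs"
    using assms arcs_of_append[of ys zs] arcs_of_append[of ys "[hd zs]"] by (cases "ys = []") auto
  ultimately show ?thesis by auto
qed

section \<open>Linking the segments\<close>

definition meets :: "'a set \<Rightarrow> 'a \<times> 'a \<Rightarrow> bool" where
  "meets W a \<longleftrightarrow> fst a \<in> W \<or> snd a \<in> W"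

text \<open>
  \<open>N\<close> edge-disjoint paths are grown simultaneously; the \<open>i\<close>-th one has to lead from \<open>r i\<close> to
  \<open>u i\<close>, and together they have to traverse given segments which cover the arcs meeting the small
  set \<open>W\<close>.
\<close>

locale linkage =
  fixes V W :: "'a set" and E :: "('a \<times> 'a) set" and n N :: nat and \<epsilon> :: real
    and r u :: "nat \<Rightarrow> 'a"
  assumes V: "finite V" "card V = n" and E: "E \<subseteq> V \<times> V"
    and anti: "\<And>a b. (a, b) \<in> E \<Longrightarrow> (b, a) \<notin> E"
    and out: "\<And>v. v \<in> V \<Longrightarrow> real (out_deg E v) \<ge> (1/2 - \<epsilon>) * n"
    and inn: "\<And>v. v \<in> V \<Longrightarrow> real (in_deg E v) \<ge> (1/2 - \<epsilon>) * n"
    and W: "W \<subseteq> V"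
    and eps: "0 < \<epsilon>" "\<epsilon> \<le> 1 / 1000" "\<epsilon> * n \<ge> 20"
    and N_bounds: "5 * n \<le> N" "8 * real N + 24 * n * card W \<le> \<epsilon>\<^sup>2 * n\<^sup>2"
    and ends: "\<And>i. i < N \<Longrightarrow> r i \<in> V - W" "\<And>i. i < N \<Longrightarrow> u i \<in> V - W"
      "\<And>i. i < N \<Longrightarrow> r i \<noteq> u i"
    and ends_count: "\<And>v. real (card {i. i < N \<and> r i = v} + card {i. i < N \<and> u i = v}) \<le> \<epsilon> * n"
begin

definition load :: "(nat \<Rightarrow> 'a list) \<Rightarrow> 'a \<Rightarrow> nat" where
  "load p z = card {i. i < N \<and> z \<in> set (p i)}"

text \<open>
  \<open>g z\<close> counts the prescribed visits of \<open>z\<close> (as start, as end or within a segment), \<open>C\<close> contains the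
  indices of the completed paths, and \<open>A\<close> the traversed arcs that meet \<open>W\<close>. The factor 6 pays for
  a segment of at most four vertices together with a connection of at most two vertices.
\<close>

definition growing :: "(nat \<Rightarrow> 'a list) \<Rightarrow> ('a \<Rightarrow> nat) \<Rightarrow> nat set \<Rightarrow> ('a \<times> 'a) set \<Rightarrow> bool" where
  "growing p g C A \<longleftrightarrow>
    (\<forall>i<N. p i \<noteq> [] \<and> distinct (p i) \<and> hd (p i) = r i \<and> set (p i) \<subseteq> V \<and> last (p i) \<notin> W \<and>
      arcs_of (p i) \<subseteq> E \<and>
      length (p i) \<le> 6 * card (W \<inter> set (p i)) + (if i \<in> C then 4 else 1)) \<and>
    (\<forall>i<N. \<forall>j<N. i \<noteq> j \<longrightarrow> arcs_of (p i) \<inter> arcs_of (p j) = {}) \<and>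
    (\<forall>z. real (load p z) \<le> \<epsilon> * n + g z) \<and>
    (\<Union>i<N. {a \<in> arcs_of (p i). meets W a}) = A"

lemma finW: "finite W" using W V finite_subset by blast

lemma card_W: "real (card W) \<le> \<epsilon> * n / 24"
proof -
  have npos: "n > 0" using eps by (cases "n = 0") auto
  have "24 * n * card W \<le> \<epsilon>\<^sup>2 * n\<^sup>2" using N_bounds by linarith
  then have "n * (24 * card W) \<le> n * (\<epsilon>\<^sup>2 * n)" by (simp add: power2_eq_square algebra_simps)
  then have "24 * real (card W) \<le> \<epsilon>\<^sup>2 * n" using npos by simp
  also have "\<dots> \<le> \<epsilon> * n" using eps by (intro mult_right_mono) (auto simp: power2_eq_square)
  finally show ?thesis by simp
qed

text \<open>Pairs of a vertex of \<open>B\<close> and a path through it are counted in two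
  ways.\<close>

lemma sum_load:
  assumes "finite B"
  shows "(\<Sum>z\<in>B. load p z) = (\<Sum>i<N. card (B \<inter> set (p i)))"
proof -
  have "(\<Sum>z\<in>B. load p z) = (\<Sum>z\<in>B. \<Sum>i<N. of_bool (z \<in> set (p i)))"
    by (intro sum.cong refl) (simp add: load_def Int_def lessThan_def sum.If_cases of_bool_def)
  also have "\<dots> = (\<Sum>i<N. \<Sum>z\<in>B. of_bool (z \<in> set (p i)))"
    by (rule sum.swap)
  also have "\<dots> = (\<Sum>i<N. card (B \<inter> set (p i)))"
    using assms by (intro sum.cong refl) (simp add: sum.If_cases of_bool_def Int_def)
  finally show ?thesis .
qed

text \<open>A path leaves z at most once, so different used arcs out of z lie on different paths
  through z.\<close>

lemma out_deg_le_load: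
  assumes "growing p g C A"
  shows "out_deg (\<Union>i<N. arcs_of (p i)) z \<le> load p z"
proof -
  let ?U = "\<Union>i<N. arcs_of (p i)"
  have ex: "\<exists>i. i < N \<and> a \<in> arcs_of (p i)" if "a \<in> {a \<in> ?U. fst a = z}" for a using that by auto
  define h where "h a = (SOME i. i < N \<and> a \<in> arcs_of (p i))" for a
  have h: "h a < N \<and> a \<in> arcs_of (p (h a))" if "a \<in> {a \<in> ?U. fst a = z}" for a
    using someI_ex[OF ex[OF that]] unfolding h_def .
  have "inj_on h {a \<in> ?U. fst a = z}"
  proof (rule inj_onI)
    fix a b assume ab: "a \<in> {a \<in> ?U. fst a = z}" "b \<in> {a \<in> ?U. fst a = z}" "h a = h b"
    have "a \<in> arcs_of (p (h a))" "b \<in> arcs_of (p (h a))" "distinct (p (h a))"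
      using h[OF ab(1)] h[OF ab(2)] ab(3) assms by (auto simp: growing_def)
    moreover have "a = (z, snd a)" "b = (z, snd b)" using ab by (simp_all add: prod_eq_iff)
    ultimately show "a = b" by (metis arcs_of_out_unique)
  qed
  moreover have "h ` {a \<in> ?U. fst a = z} \<subseteq> {i. i < N \<and> z \<in> set (p i)}"
  proof
    fix i assume "i \<in> h ` {a \<in> ?U. fst a = z}"
    then obtain a where a: "a \<in> {a \<in> ?U. fst a = z}" "i = h a" by blast
    then have "i < N" "(z, snd a) \<in> arcs_of (p i)" using h[OF a(1)] by auto
    then show "i \<in> {i. i < N \<and> z \<in> set (p i)}" using arcs_of_verts by fastforce
  qed
  ultimately show ?thesis unfolding out_deg_def load_def by (intro card_inj_on_le) auto
qed

lemma in_deg_le_load: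
  assumes "growing p g C A"
  shows "in_deg (\<Union>i<N. arcs_of (p i)) z \<le> load p z"
proof -
  let ?U = "\<Union>i<N. arcs_of (p i)"
  have ex: "\<exists>i. i < N \<and> a \<in> arcs_of (p i)" if "a \<in> {a \<in> ?U. snd a = z}" for a using that by auto
  define h where "h a = (SOME i. i < N \<and> a \<in> arcs_of (p i))" for a
  have h: "h a < N \<and> a \<in> arcs_of (p (h a))" if "a \<in> {a \<in> ?U. snd a = z}" for a
    using someI_ex[OF ex[OF that]] unfolding h_def .
  have "inj_on h {a \<in> ?U. snd a = z}"
  proof (rule inj_onI)
    fix a b assume ab: "a \<in> {a \<in> ?U. snd a = z}" "b \<in> {a \<in> ?U. snd a = z}" "h a = h b"
    have "a \<in> arcs_of (p (h a))" "b \<in> arcs_of (p (h a))" "distinct (p (h a))"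
      using h[OF ab(1)] h[OF ab(2)] ab(3) assms by (auto simp: growing_def)
    moreover have "a = (fst a, z)" "b = (fst b, z)" using ab by (simp_all add: prod_eq_iff)
    ultimately show "a = b" by (metis arcs_of_in_unique)
  qed
  moreover have "h ` {a \<in> ?U. snd a = z} \<subseteq> {i. i < N \<and> z \<in> set (p i)}"
  proof
    fix i assume "i \<in> h ` {a \<in> ?U. snd a = z}"
    then obtain a where a: "a \<in> {a \<in> ?U. snd a = z}" "i = h a" by blast
    then have "i < N" "(fst a, z) \<in> arcs_of (p i)" using h[OF a(1)] by auto
    then show "i \<in> {i. i < N \<and> z \<in> set (p i)}" using arcs_of_verts by fastforce
  qed
  ultimately show ?thesis unfolding in_deg_def load_def by (intro card_inj_on_le) auto
qed

text \<open>Double counting of visits: by the length bounds the load on any vertex set is at most 6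
  times the load on \<open>W\<close> plus 4 N, hence at most 12 n |W| + 4 N. A saturated vertex has
  load at least eps * n / 2, and \<open>N_bounds\<close> makes the quotient at most eps * n.\<close>

lemma few_saturated:
  assumes g: "growing p g C A" and gW: "\<And>w. w \<in> W \<Longrightarrow> g w \<le> n"
  shows "real (card {z \<in> V. real (load p z) + 1 > \<epsilon> * n}) \<le> \<epsilon> * n"
proof -
  define Z where "Z = {z \<in> V. real (load p z) + 1 > \<epsilon> * n}"
  have fZ: "finite Z" using V by (simp add: Z_def)
  have len: "card (Z \<inter> set (p i)) \<le> 6 * card (W \<inter> set (p i)) + 4" if "i < N" for i
  proof -
    have "card (Z \<inter> set (p i)) \<le> card (set (p i))" by (intro card_mono) auto
    also have "\<dots> \<le> length (p i)" by (rule card_length)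
    also have "\<dots> \<le> 6 * card (W \<inter> set (p i)) + (if i \<in> C then 4 else 1)"
      using g that by (auto simp: growing_def)
    also have "\<dots> \<le> 6 * card (W \<inter> set (p i)) + 4" by simp
    finally show ?thesis .
  qed
  have W2: "load p w \<le> 2 * real n" if "w \<in> W" for w
  proof -
    have "real (load p w) \<le> \<epsilon> * n + g w" using g by (auto simp: growing_def)
    moreover have "\<epsilon> * real n \<le> 1 * real n" using eps by (intro mult_right_mono) auto
    ultimately show ?thesis using gW[OF that] by linarith
  qed
  have "(\<epsilon> * n / 2) * card Z = (\<Sum>z\<in>Z. \<epsilon> * n / 2)" by simp
  also have "\<dots> \<le> (\<Sum>z\<in>Z. real (load p z))"
    using eps by (intro sum_mono) (auto simp: Z_def)
  also have "\<dots> = real (\<Sum>i<N. card (Z \<inter> set (p i)))"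
    using sum_load[OF fZ, of p] by (simp flip: of_nat_sum)
  also have "\<dots> \<le> real (\<Sum>i<N. 6 * card (W \<inter> set (p i)) + 4)"
    by (intro of_nat_mono sum_mono len) auto
  also have "(\<Sum>i<N. 6 * card (W \<inter> set (p i)) + 4) = 6 * (\<Sum>w\<in>W. load p w) + 4 * N"
    by (simp add: sum.distrib sum_load[OF finW] sum_distrib_left)
  also have "real \<dots> \<le> 6 * (\<Sum>w\<in>W. 2 * real n) + 4 * N"
    using sum_mono[of W "\<lambda>w. real (load p w)" "\<lambda>_. 2 * real n"] W2 by (simp add: mult_ac)
  also have "\<dots> \<le> \<epsilon>\<^sup>2 * n\<^sup>2 / 2" using N_bounds(2) by (simp add: mult_ac)
  finally have "(\<epsilon> * n / 2) * card Z \<le> (\<epsilon> * n / 2) * (\<epsilon> * n)"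
    by (simp add: power2_eq_square algebra_simps)
  then have "real (card Z) \<le> \<epsilon> * n"
    using eps by (subst (asm) mult_le_cancel_left_pos) auto
  then show ?thesis by (simp add: Z_def)
qed

text \<open>Used both for appending a segment and for closing a path by its last vertex. The budget
  keeps loads outside \<open>W\<close> at most 3 * eps * n, which is what
  \<open>short_connection\<close> tolerates. The connection avoids saturated vertices, so only
  vertices of \<open>xs\<close> may exceed the old budget, and the new \<open>g\<close> pays for
  them.\<close>

lemma extend_path:
  assumes g: "growing p g C A" and gb: "\<And>w. w \<in> W \<Longrightarrow> g w \<le> n"
      "\<And>z. z \<in> V - W \<Longrightarrow> real (g z) \<le> 2 * \<epsilon> * n"
    and i: "i < N" "i \<notin> C"
    and xs: "xs \<noteq> []" "distinct xs" "set xs \<subseteq> V" "hd xs \<notin> W" "last xs \<notin> W"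
      "set xs \<inter> set (p i) = {}" "arcs_of xs \<subseteq> E" "arcs_of xs \<inter> A = {}"
      "\<And>a. a \<in> arcs_of xs \<Longrightarrow> meets W a" "length xs \<le> 4"
    and C': "C' = C \<and> set xs \<inter> W \<noteq> {} \<or> C' = insert i C \<and> length xs = 1"
  shows "\<exists>ys. growing (p(i := p i @ ys @ xs)) (\<lambda>z. g z + of_bool (z \<in> set xs)) C' (A \<union> arcs_of xs)
    \<and> u i \<notin> set ys"
proof -
  define Z where "Z = {z \<in> V. real (load p z) + 1 > \<epsilon> * n}"
  define U where "U = (\<Union>i<N. arcs_of (p i))"
  \<comment> \<open>The end \<open>u i\<close> is forbidden as well, so that it is still fresh when
    the path is closed. The size is at most |W| + |Z| + (6 |W| + 1) + 4 + 1.\<close>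
  define X where "X = W \<union> Z \<union> set (p i) \<union> set xs \<union> {u i}"
  have Z: "real (card Z) \<le> \<epsilon> * n" unfolding Z_def by (rule few_saturated[OF g gb(1)])
  have pi: "p i \<noteq> []" "distinct (p i)" "hd (p i) = r i" "set (p i) \<subseteq> V" "last (p i) \<notin> W"
      "arcs_of (p i) \<subseteq> E" "length (p i) \<le> 6 * card (W \<inter> set (p i)) + 1"
    using g i by (auto simp: growing_def)
  have ld: "real (load p z) \<le> \<epsilon> * n + g z" for z using g by (auto simp: growing_def)
  have fX: "finite X" using finW V by (auto simp: X_def Z_def)
  have cp: "card (set (p i)) \<le> 6 * card W + 1"
    using card_length[of "p i"] pi(7) card_mono[of W "W \<inter> set (p i)"] finW
    by (metis add_le_mono1 inf_le1 mult_le_mono2 order_trans)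
  have "card X \<le> card W + card Z + card (set (p i)) + card (set xs) + card {u i}"
    unfolding X_def by (rule order_trans[OF card_Un_le] add_mono order_refl)+
  also have "\<dots> \<le> 7 * card W + card Z + 6"
    using cp card_length[of xs] xs(10) by simp
  finally have "real (card X) \<le> 7 * card W + card Z + 6" by linarith
  then have cX: "real (card X) \<le> 3 * \<epsilon> * n" using card_W Z eps by simp
  have bound: "real (load p z) \<le> 3 * \<epsilon> * n" if "z \<in> V - W" for z
    using ld[of z] gb(2)[OF that] by simp
  have lastV: "last (p i) \<in> V - W" and hdV: "hd xs \<in> V - W"
    using pi xs hd_in_set[OF xs(1)] last_in_set[OF pi(1)] by auto
  have U: "real (out_deg U z) \<le> 3 * \<epsilon> * n" "real (in_deg U z) \<le> 3 * \<epsilon> * n" if "z \<in> V - W" for z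
    using out_deg_le_load[OF g, of z] in_deg_le_load[OF g, of z] bound[OF that]
    by (simp_all add: U_def)
  have XW: "V - X \<subseteq> V - W" by (auto simp: X_def)
  have "\<exists>ys. ys \<noteq> [] \<and> length ys \<le> 2 \<and> distinct ys \<and> set ys \<subseteq> V - X - {last (p i), hd xs} \<and>
    arcs_of (last (p i) # ys @ [hd xs]) \<subseteq> E - U"
    by (rule short_connection[OF V E anti out inn])
      (use U XW lastV hdV fX cX eps in \<open>auto simp: U_def\<close>)
  then obtain ys where ys: "length ys \<le> 2" "distinct ys" "set ys \<subseteq> V - X"
    "arcs_of (last (p i) # ys @ [hd xs]) \<subseteq> E - U" by blast
  let ?p = "p(i := p i @ ys @ xs)"
  let ?c = "arcs_of (last (p i) # ys @ [hd xs])"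
  have arcs: "arcs_of (p i @ ys @ xs) = arcs_of (p i) \<union> ?c \<union> arcs_of xs"
    using pi xs by (intro arcs_of_append_connection)
  have cW: "\<not> meets W a" if "a \<in> ?c" for a
  proof -
    have "fst a \<in> set (last (p i) # ys @ [hd xs])" "snd a \<in> set (last (p i) # ys @ [hd xs])"
      using arcs_of_verts[of "fst a" "snd a" "last (p i) # ys @ [hd xs]"] that by simp_all
    moreover have "set (last (p i) # ys @ [hd xs]) \<inter> W = {}"
      using lastV hdV ys(3) by (auto simp: X_def)
    ultimately show ?thesis by (auto simp: meets_def)
  qed
  have WI: "card (W \<inter> set (p i @ ys @ xs)) = card (W \<inter> set (p i)) + card (W \<inter> set xs)"
  proof -
    have "W \<inter> set (p i @ ys @ xs) = (W \<inter> set (p i)) \<union> (W \<inter> set xs)"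
      using ys(3) by (auto simp: X_def)
    moreover have "(W \<inter> set (p i)) \<inter> (W \<inter> set xs) = {}" using xs(6) by auto
    ultimately show ?thesis using finW by (metis card_Un_disjoint finite_Int)
  qed
  have "growing ?p (\<lambda>z. g z + of_bool (z \<in> set xs)) C' (A \<union> arcs_of xs)"
    unfolding growing_def
  proof (intro conjI allI impI)
    fix j assume j: "j < N"
    have pj: "p j \<noteq> []" "distinct (p j)" "hd (p j) = r j" "set (p j) \<subseteq> V" "last (p j) \<notin> W"
      "arcs_of (p j) \<subseteq> E" "length (p j) \<le> 6 * card (W \<inter> set (p j)) + (if j \<in> C then 4 else 1)"
      using g j by (auto simp: growing_def)
    show "?p j \<noteq> []" "hd (?p j) = r j" using pj pi by auto
    show "distinct (?p j)" using pj pi xs ys by (auto simp: X_def)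
    show "set (?p j) \<subseteq> V" using pj pi xs ys by auto
    show "last (?p j) \<notin> W" using pj xs by auto
    show "arcs_of (?p j) \<subseteq> E" using pj pi xs ys by (auto simp: arcs)
    show "length (?p j) \<le> 6 * card (W \<inter> set (?p j)) + (if j \<in> C' then 4 else 1)"
    proof (cases "j = i")
      case True
      have "length (p i @ ys @ xs) \<le> 6 * card (W \<inter> set (p i)) + 1 + 2 + length xs"
        using pi ys by simp
      \<comment> \<open>A segment meets \<open>W\<close> and gains 6, enough for its 4 vertices and
        the 2 of the connection. Closing adds at most 2 + 1 vertices, which is the rise of the
        constant from 1 to 4.\<close>
      moreover have "length xs + 2 \<le> 6 * card (W \<inter> set xs) + (if i \<in> C' then 3 else 0)"
      proof (cases "C' = C \<and> set xs \<inter> W \<noteq> {}")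
        case True
        then have "card (W \<inter> set xs) > 0" using finW by (auto simp: card_gt_0_iff)
        then show ?thesis using xs(10) by simp
      next
        case False
        then show ?thesis using C' by auto
      qed
      ultimately show ?thesis using True WI by (simp split: if_splits)
    next
      case False
      then show ?thesis using pj C' by auto
    qed
    fix k assume k: "k < N" "j \<noteq> k"
    have disj: "arcs_of (p j) \<inter> arcs_of (p k) = {}" using g j k by (auto simp: growing_def)
    have new: "arcs_of (p i @ ys @ xs) \<inter> arcs_of (p l) = {}" if "l < N" "l \<noteq> i" for l
    proof -
      have "arcs_of (p i) \<inter> arcs_of (p l) = {}" using g i that by (auto simp: growing_def)
      moreover have "?c \<inter> arcs_of (p l) = {}" using ys(4) that by (auto simp: U_def)
      moreover have "arcs_of xs \<inter> arcs_of (p l) = {}"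
        using g that xs(8,9) by (auto simp: growing_def)
      ultimately show ?thesis by (auto simp: arcs)
    qed
    show "arcs_of (?p j) \<inter> arcs_of (?p k) = {}"
      using disj new[of j] new[of k] j k by auto
  next
    fix z
    show "real (load ?p z) \<le> \<epsilon> * n + real (g z + of_bool (z \<in> set xs))"
    proof (cases "z \<in> set ys \<union> set xs")
      case True
      have "load ?p z \<le> card (insert i {j. j < N \<and> z \<in> set (p j)})"
        unfolding load_def by (intro card_mono) auto
      also have "\<dots> \<le> load p z + 1" by (simp add: load_def card_insert_if)
      finally have "real (load ?p z) \<le> load p z + 1" by linarith
      moreover have "real (load p z) + 1 \<le> \<epsilon> * n" if "z \<notin> set xs"
        using True that ys(3) by (auto simp: X_def Z_def)
      ultimately show ?thesis using ld[of z] by (cases "z \<in> set xs") auto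
    next
      case False
      have "{j. j < N \<and> z \<in> set (?p j)} = {j. j < N \<and> z \<in> set (p j)}"
        using False by auto
      then show ?thesis using ld[of z] False by (simp add: load_def)
    qed
  next
    have A: "(\<Union>i<N. {a \<in> arcs_of (p i). meets W a}) = A" using g by (auto simp: growing_def)
    have "{a \<in> arcs_of (?p j). meets W a} = {a \<in> arcs_of (p j). meets W a} \<union>
      (if j = i then arcs_of xs else {})" for j
      using cW xs(9) by (auto simp: arcs)
    then have "(\<Union>j<N. {a \<in> arcs_of (?p j). meets W a}) =
      (\<Union>j<N. {a \<in> arcs_of (p j). meets W a} \<union> (if j = i then arcs_of xs else {}))" by simp
    also have "\<dots> = A \<union> arcs_of xs" unfolding A [symmetric] using i(1) by (auto split: if_splits)
    finally show "(\<Union>j<N. {a \<in> arcs_of (?p j). meets W a}) = A \<union> arcs_of xs" .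
  qed
  moreover have "u i \<notin> set ys" using ys(3) by (auto simp: X_def)
  ultimately show ?thesis by blast
qed

text \<open>Each new segment is appended to some path that has met none of its vertices and does not
  have to end on it; the bound 5 n <= N guarantees such a path. The ends \<open>u i\<close> are kept
  off the unfinished paths.\<close>

lemma traverse_segments:
  assumes "finite S" and "\<And>xs. xs \<in> S \<Longrightarrow> distinct xs \<and> 3 \<le> length xs \<and> length xs \<le> 4 \<and>
      hd xs \<notin> W \<and> last xs \<notin> W \<and> set xs \<inter> W \<noteq> {} \<and> set xs \<subseteq> V \<and> arcs_of xs \<subseteq> E"
    and "\<And>xs a. xs \<in> S \<Longrightarrow> a \<in> arcs_of xs \<Longrightarrow> meets W a"
    and "disjoint_family_on arcs_of S"
    and "\<And>w. w \<in> W \<Longrightarrow> card {xs \<in> S. w \<in> set xs} \<le> n"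
    and "\<And>z. z \<in> V - W \<Longrightarrow> real (card {xs \<in> S. z \<in> set xs}) \<le> \<epsilon> * n"
  shows "\<exists>p. growing p (\<lambda>z. card {i. i < N \<and> r i = z} + card {xs \<in> S. z \<in> set xs}) {}
      (\<Union>xs\<in>S. arcs_of xs) \<and> (\<forall>i<N. u i \<notin> set (p i))"
  using assms
proof (induction S rule: finite_induct)
  case empty
  have "growing (\<lambda>i. [r i]) (\<lambda>z. card {i. i < N \<and> r i = z}) {} {}"
    using eps ends by (auto simp: growing_def load_def eq_commute[of _ "r _"] intro: add_increasing)
  then show ?case by (intro exI[of _ "\<lambda>i. [r i]"]) (auto simp: ends(3)[THEN not_sym])
next
  case (insert xs S)
  have le: "card {ys \<in> S. z \<in> set ys} \<le> card {ys \<in> insert xs S. z \<in> set ys}" for z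
    using insert.hyps by (intro card_mono) auto
  have "\<exists>p. growing p (\<lambda>z. card {i. i < N \<and> r i = z} + card {xs \<in> S. z \<in> set xs}) {}
      (\<Union>xs\<in>S. arcs_of xs) \<and> (\<forall>i<N. u i \<notin> set (p i))"
  proof (rule insert.IH)
    show "disjoint_family_on arcs_of S"
      using insert.prems(3) by (auto simp: disjoint_family_on_def)
    show "card {xs \<in> S. w \<in> set xs} \<le> n" if "w \<in> W" for w
      using insert.prems(4)[OF that] le[of w] by simp
    show "real (card {xs \<in> S. z \<in> set xs}) \<le> \<epsilon> * n" if "z \<in> V - W" for z
      using insert.prems(5)[OF that] le[of z] by linarith
    show "meets W a" if "ys \<in> S" "a \<in> arcs_of ys" for ys a
      using insert.prems(2)[OF _ that(2)] that(1) by blast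
  qed (use insert.prems(1) in blast)
  then obtain p where p: "growing p (\<lambda>z. card {i. i < N \<and> r i = z} + card {xs \<in> S. z \<in> set xs}) {}
      (\<Union>xs\<in>S. arcs_of xs)" "\<forall>i<N. u i \<notin> set (p i)" by blast
  have xs: "distinct xs" "3 \<le> length xs" "length xs \<le> 4" "hd xs \<notin> W" "last xs \<notin> W"
    "set xs \<inter> W \<noteq> {}" "set xs \<subseteq> V" "arcs_of xs \<subseteq> E" using insert.prems(1) by blast+
  let ?g = "\<lambda>z. card {i. i < N \<and> r i = z} + card {xs \<in> S. z \<in> set xs}"
  have npos: "n > 0" using eps by (cases "n = 0") auto
  have en: "\<epsilon> * real n \<le> 1 / 1000 * real n" using eps by (intro mult_right_mono) auto
  have rW: "{i. i < N \<and> r i = w} = {}" "{i. i < N \<and> u i = w} = {}" if "w \<in> W" for w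
    using ends that by auto
  have gW: "?g w \<le> n" if "w \<in> W" for w
    unfolding rW[OF that] using insert.prems(4)[OF that] le[of w] by simp
  have gV: "real (?g z) \<le> 2 * \<epsilon> * n" if "z \<in> V - W" for z
    using insert.prems(5)[OF that] le[of z] ends_count[of z] by simp
  \<comment> \<open>Counts the paths that z blocks. At most n comes from segments through a vertex
    of \<open>W\<close>; the remaining contributions are at most 3 * eps * n.\<close>
  have hit: "real (card {i. i < N \<and> (z \<in> set (p i) \<or> u i = z)}) \<le> 1.01 * n" if "z \<in> V" for z
  proof -
    have "{i. i < N \<and> (z \<in> set (p i) \<or> u i = z)} = {i. i < N \<and> z \<in> set (p i)} \<union> {i. i < N \<and> u i = z}"
      by auto
    then have "card {i. i < N \<and> (z \<in> set (p i) \<or> u i = z)} \<le> load p z + card {i. i < N \<and> u i = z}"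
      by (simp add: load_def card_Un_le)
    moreover have "real (load p z) \<le> \<epsilon> * n + real (?g z)" using p(1) unfolding growing_def by blast
    moreover have "real (?g z) + card {i. i < N \<and> u i = z} \<le> n + 2 * \<epsilon> * n"
    proof (cases "z \<in> W")
      case True
      have "card {xs \<in> S. z \<in> set xs} \<le> n" using insert.prems(4)[OF True] le[of z] by linarith
      then show ?thesis unfolding rW[OF True] using eps by simp
    next
      case False
      then have "real (card {xs \<in> S. z \<in> set xs}) \<le> \<epsilon> * n"
        using insert.prems(5)[of z] le[of z] that by fastforce
      then show ?thesis using ends_count[of z] by simp
    qed
    ultimately show ?thesis using en by simp
  qed
  \<comment> \<open>At most four vertices block at most 4.04 n paths, fewer than 5 n.\<close>
  define Bl where "Bl = {i. i < N \<and> (set xs \<inter> set (p i) \<noteq> {} \<or> u i \<in> set xs)}"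
  have "Bl = (\<Union>z\<in>set xs. {i. i < N \<and> (z \<in> set (p i) \<or> u i = z)})" by (auto simp: Bl_def)
  then have "card Bl \<le> (\<Sum>z\<in>set xs. card {i. i < N \<and> (z \<in> set (p i) \<or> u i = z)})"
    using card_UN_le[of "set xs" "\<lambda>z. {i. i < N \<and> (z \<in> set (p i) \<or> u i = z)}"] by simp
  then have "real (card Bl) \<le> (\<Sum>z\<in>set xs. real (card {i. i < N \<and> (z \<in> set (p i) \<or> u i = z)}))"
    by (simp flip: of_nat_sum)
  also have "\<dots> \<le> (\<Sum>z\<in>set xs. 1.01 * real n)"
    using hit xs(7) by (intro sum_mono) auto
  also have "\<dots> \<le> 4 * (1.01 * real n)"
  proof -
    have "real (card (set xs)) \<le> 4" using xs(3) card_length[of xs] by linarith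
    from mult_right_mono[OF this, of "1.01 * real n"] show ?thesis by simp
  qed
  also have "\<dots> < real N" using N_bounds(1) npos by simp
  finally have "card Bl < N" by simp
  moreover have "Bl \<subseteq> {..<N}" by (auto simp: Bl_def)
  ultimately have "Bl \<noteq> {..<N}" by auto
  with \<open>Bl \<subseteq> {..<N}\<close> obtain i where i: "i < N" "set xs \<inter> set (p i) = {}" "u i \<notin> set xs"
    by (auto simp: Bl_def)
  have "arcs_of xs \<inter> (\<Union>xs\<in>S. arcs_of xs) = {}"
    using insert.prems(3) insert.hyps by (auto simp: disjoint_family_on_def)
  then have "\<exists>ys. growing (p(i := p i @ ys @ xs)) (\<lambda>z. ?g z + of_bool (z \<in> set xs)) {}
    ((\<Union>xs\<in>S. arcs_of xs) \<union> arcs_of xs) \<and> u i \<notin> set ys"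
    by (intro extend_path[OF p(1) gW gV i(1)]) (use xs i insert.prems(2)[OF insertI1] in auto)
  then obtain ys where ys: "growing (p(i := p i @ ys @ xs)) (\<lambda>z. ?g z + of_bool (z \<in> set xs)) {}
    ((\<Union>xs\<in>S. arcs_of xs) \<union> arcs_of xs)" "u i \<notin> set ys" by blast
  have "card {ys \<in> insert xs S. z \<in> set ys} = card {ys \<in> S. z \<in> set ys} + of_bool (z \<in> set xs)" for z
  proof -
    have "{ys \<in> insert xs S. z \<in> set ys} =
      (if z \<in> set xs then insert xs {ys \<in> S. z \<in> set ys} else {ys \<in> S. z \<in> set ys})" by auto
    then show ?thesis using insert.hyps by simp
  qed
  then have geq: "(\<lambda>z. ?g z + of_bool (z \<in> set xs)) =
      (\<lambda>z. card {i. i < N \<and> r i = z} + card {ys \<in> insert xs S. z \<in> set ys})"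
    by (simp add: fun_eq_iff)
  have aeq: "(\<Union>xs\<in>S. arcs_of xs) \<union> arcs_of xs = (\<Union>xs\<in>insert xs S. arcs_of xs)" by auto
  show ?case
    using ys(1) unfolding geq aeq
    by (intro exI[of _ "p(i := p i @ ys @ xs)"] conjI) (assumption | use ys(2) i p(2) in auto)+
qed

text \<open>The list \<open>[u m]\<close> plays the role of the segment in
  \<open>extend_path\<close>. Closing one path leaves the others unchanged, so later ends remain
  fresh.\<close>

lemma close_paths:
  assumes p: "growing p g {} A" "\<forall>i<N. u i \<notin> set (p i)"
    and gb: "\<And>w. w \<in> W \<Longrightarrow> g w \<le> n"
      "\<And>z. z \<in> V - W \<Longrightarrow> real (g z + card {i. i < N \<and> u i = z}) \<le> 2 * \<epsilon> * n"
    and m: "m \<le> N"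
  shows "\<exists>q. growing q (\<lambda>z. g z + card {i. i < m \<and> u i = z}) {..<m} A \<and>
    (\<forall>i<N. if i < m then last (q i) = u i else u i \<notin> set (q i))"
  using m
proof (induction m)
  case 0
  then show ?case using p by (intro exI[of _ p]) auto
next
  case (Suc m)
  let ?g = "\<lambda>z. g z + card {i. i < m \<and> u i = z}"
  obtain q where q: "growing q ?g {..<m} A"
    "\<forall>i<N. if i < m then last (q i) = u i else u i \<notin> set (q i)" using Suc by auto
  have gW: "?g w \<le> n" if "w \<in> W" for w
  proof -
    have e: "{i. i < m \<and> u i = w} = {}" using ends that Suc.prems by fastforce
    show ?thesis unfolding e using gb(1)[OF that] by simp
  qed
  have gV: "real (?g z) \<le> 2 * \<epsilon> * n" if "z \<in> V - W" for z
  proof -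
    have "card {i. i < m \<and> u i = z} \<le> card {i. i < N \<and> u i = z}"
      using Suc by (intro card_mono) auto
    then show ?thesis using gb(2)[OF that] by linarith
  qed
  have "\<exists>ys. growing (q(m := q m @ ys @ [u m])) (\<lambda>z. ?g z + of_bool (z \<in> set [u m])) {..<Suc m}
    (A \<union> arcs_of [u m]) \<and> u m \<notin> set ys"
    by (intro extend_path[OF q(1) gW gV]) (use Suc ends[of m] q(2) in auto)
  then obtain ys where ys: "growing (q(m := q m @ ys @ [u m]))
      (\<lambda>z. ?g z + of_bool (z \<in> set [u m])) {..<Suc m} A" by auto
  have "card {i. i < Suc m \<and> u i = z} = card {i. i < m \<and> u i = z} + of_bool (z \<in> set [u m])" for z
  proof -
    have "{i. i < Suc m \<and> u i = z} =
      (if z = u m then insert m {i. i < m \<and> u i = z} else {i. i < m \<and> u i = z})"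
      by (auto simp: less_Suc_eq)
    then show ?thesis by simp
  qed
  then have geq: "(\<lambda>z. ?g z + of_bool (z \<in> set [u m])) = (\<lambda>z. g z + card {i. i < Suc m \<and> u i = z})"
    by (simp add: fun_eq_iff)
  show ?case
    using ys q(2) unfolding geq by (intro exI[of _ "q(m := q m @ ys @ [u m])"] conjI) (assumption | auto simp: less_Suc_eq)+
qed

text \<open>The visit bounds for the segments come from disjointness: each segment through z has its
  own arc at z that meets \<open>W\<close>. There are at most n such arcs if z lies in
  \<open>W\<close>, and at most |W| otherwise.\<close>

lemma ex_linkage:
  assumes S: "finite S" "\<And>xs. xs \<in> S \<Longrightarrow> distinct xs \<and> 3 \<le> length xs \<and> length xs \<le> 4 \<and>
      hd xs \<notin> W \<and> last xs \<notin> W \<and> set xs \<inter> W \<noteq> {}" "disjoint_family_on arcs_of S"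
    and un: "(\<Union>xs\<in>S. arcs_of xs) \<subseteq> {a \<in> E. meets W a}"
  shows "\<exists>p. (\<forall>i<N. distinct (p i) \<and> length (p i) \<ge> 2 \<and> hd (p i) = r i \<and> last (p i) = u i \<and>
      arcs_of (p i) \<subseteq> E) \<and>
    disjoint_family_on (\<lambda>i. arcs_of (p i)) {..<N} \<and>
    (\<Union>i<N. {a \<in> arcs_of (p i). meets W a}) = (\<Union>xs\<in>S. arcs_of xs) \<and>
    (\<forall>v\<in>V - W. real (out_deg (\<Union>i<N. arcs_of (p i)) v) \<le> 3 * \<epsilon> * n \<and>
      real (in_deg (\<Union>i<N. arcs_of (p i)) v) \<le> 3 * \<epsilon> * n)"
proof -
  have fE: "finite E" using E V finite_subset by blast
  have npos: "n > 0" using eps by (cases "n = 0") auto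
  have SV: "set xs \<subseteq> V" if "xs \<in> S" for xs
  proof
    fix z assume "z \<in> set xs"
    then obtain a where "a \<in> arcs_of xs" "fst a = z \<or> snd a = z"
      using vertex_in_arc[of z xs] S(2)[OF \<open>xs \<in> S\<close>] by auto
    then show "z \<in> V" using un E that by fastforce
  qed
  have cnt: "card {xs \<in> S. z \<in> set xs} \<le> card {a \<in> E. meets W a \<and> (fst a = z \<or> snd a = z)}" for z
  proof (rule card_family_hitting)
    show "finite {a \<in> E. meets W a \<and> (fst a = z \<or> snd a = z)}" using fE by simp
    show "disjoint_family_on arcs_of {xs \<in> S. z \<in> set xs}"
      using S(3) by (auto simp: disjoint_family_on_def)
    fix xs assume "xs \<in> {xs \<in> S. z \<in> set xs}"
    then have "xs \<in> S" "z \<in> set xs" by auto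
    then obtain a where "a \<in> arcs_of xs" "fst a = z \<or> snd a = z"
      using vertex_in_arc[of z xs] S(2)[of xs] by auto
    then show "arcs_of xs \<inter> {a \<in> E. meets W a \<and> (fst a = z \<or> snd a = z)} \<noteq> {}"
      using un \<open>xs \<in> S\<close> by fastforce
  qed
  \<comment> \<open>Without antiparallel arcs, an arc at z is determined by its other
    endpoint.\<close>
  have opp: "card {a \<in> E. snd a \<in> B \<and> fst a = z \<or> fst a \<in> B \<and> snd a = z} \<le> card B" if "finite B" for B z
  proof (rule card_inj_on_le[where f = "\<lambda>a. if fst a = z then snd a else fst a"])
    show "inj_on (\<lambda>a. if fst a = z then snd a else fst a)
      {a \<in> E. snd a \<in> B \<and> fst a = z \<or> fst a \<in> B \<and> snd a = z}"
    proof (rule inj_onI)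
      fix a b assume "a \<in> {a \<in> E. snd a \<in> B \<and> fst a = z \<or> fst a \<in> B \<and> snd a = z}"
        "b \<in> {a \<in> E. snd a \<in> B \<and> fst a = z \<or> fst a \<in> B \<and> snd a = z}"
        "(if fst a = z then snd a else fst a) = (if fst b = z then snd b else fst b)"
      then show "a = b" using anti by (cases a; cases b) (auto split: if_splits)
    qed
  qed (use that in auto)
  have cW: "card {xs \<in> S. w \<in> set xs} \<le> n" if "w \<in> W" for w
  proof -
    have "{a \<in> E. meets W a \<and> (fst a = w \<or> snd a = w)} \<subseteq>
      {a \<in> E. snd a \<in> V \<and> fst a = w \<or> fst a \<in> V \<and> snd a = w}" using E by auto
    from card_mono[OF _ this] show ?thesis
      using cnt[of w] opp[OF V(1), of w] V(2) fE by simp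
  qed
  have cV: "real (card {xs \<in> S. z \<in> set xs}) \<le> \<epsilon> * n" if "z \<in> V - W" for z
  proof -
    have "{a \<in> E. meets W a \<and> (fst a = z \<or> snd a = z)} \<subseteq>
      {a \<in> E. snd a \<in> W \<and> fst a = z \<or> fst a \<in> W \<and> snd a = z}" using that by (auto simp: meets_def)
    from card_mono[OF _ this] have "card {xs \<in> S. z \<in> set xs} \<le> card W"
      using cnt[of z] opp[OF finW, of z] fE by simp
    then have "real (card {xs \<in> S. z \<in> set xs}) \<le> real (card W)" by simp
    then show ?thesis using card_W eps by linarith
  qed
  let ?g = "\<lambda>z. card {i. i < N \<and> r i = z} + card {xs \<in> S. z \<in> set xs}"
  have "\<exists>p. growing p ?g {} (\<Union>xs\<in>S. arcs_of xs) \<and> (\<forall>i<N. u i \<notin> set (p i))"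
  proof (rule traverse_segments[OF S(1) _ _ S(3) cW cV])
    show "meets W a" if "xs \<in> S" "a \<in> arcs_of xs" for xs a using un that by auto
    show "distinct xs \<and> 3 \<le> length xs \<and> length xs \<le> 4 \<and>
      hd xs \<notin> W \<and> last xs \<notin> W \<and> set xs \<inter> W \<noteq> {} \<and> set xs \<subseteq> V \<and> arcs_of xs \<subseteq> E" if "xs \<in> S" for xs
      using S(2)[OF that] SV[OF that] un that by blast
  qed
  then obtain p where p: "growing p ?g {} (\<Union>xs\<in>S. arcs_of xs)" "\<forall>i<N. u i \<notin> set (p i)" by blast
  have gW: "?g w \<le> n" if "w \<in> W" for w
  proof -
    have e: "{i. i < N \<and> r i = w} = {}" using ends that by auto
    show ?thesis unfolding e using cW[OF that] by simp
  qed
  have gV: "real (?g z + card {i. i < N \<and> u i = z}) \<le> 2 * \<epsilon> * n" if "z \<in> V - W" for z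
    using cV[OF that] ends_count[of z] by simp
  obtain q where q: "growing q (\<lambda>z. ?g z + card {i. i < N \<and> u i = z}) {..<N} (\<Union>xs\<in>S. arcs_of xs)"
    "\<forall>i<N. last (q i) = u i"
    using close_paths[OF p gW gV order_refl] by auto
  have ld: "real (load q z) \<le> 3 * \<epsilon> * n" if "z \<in> V - W" for z
  proof -
    have "real (load q z) \<le> \<epsilon> * n + real (?g z + card {i. i < N \<and> u i = z})"
      using q(1) unfolding growing_def by blast
    then show ?thesis using gV[OF that] by linarith
  qed
  show ?thesis
  proof (intro exI[of _ q] conjI allI impI ballI)
    fix i assume i: "i < N"
    have qi: "q i \<noteq> []" "distinct (q i)" "hd (q i) = r i" "arcs_of (q i) \<subseteq> E"
      using q(1) i by (auto simp: growing_def)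
    then show "distinct (q i)" "hd (q i) = r i" "arcs_of (q i) \<subseteq> E" by auto
    show "last (q i) = u i" using q i by auto
    then show "2 \<le> length (q i)" using qi ends(3)[OF i] by (cases "q i"; cases "tl (q i)") auto
  next
    show "disjoint_family_on (\<lambda>i. arcs_of (q i)) {..<N}"
      using q(1) by (auto simp: growing_def disjoint_family_on_def)
    show "(\<Union>i<N. {a \<in> arcs_of (q i). meets W a}) = (\<Union>xs\<in>S. arcs_of xs)"
      using q(1) by (simp add: growing_def)
  next
    fix v assume v: "v \<in> V - W"
    show "real (out_deg (\<Union>i<N. arcs_of (q i)) v) \<le> 3 * \<epsilon> * n"
      "real (in_deg (\<Union>i<N. arcs_of (q i)) v) \<le> 3 * \<epsilon> * n"
      using out_deg_le_load[OF q(1), of v] in_deg_le_load[OF q(1), of v] ld[OF v] by linarith+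
  qed
qed

end

section \<open>Prolonging a perfect decomposition\<close>

text \<open>Passing from an indexed family to a set of paths loses none, because the arc sets are
  nonempty and pairwise disjoint.\<close>

lemma perfect_paths_family:
  assumes "finite I" "\<And>i. i \<in> I \<Longrightarrow> distinct (q i) \<and> length (q i) \<ge> 2"
    and "disjoint_family_on (\<lambda>i. arcs_of (q i)) I" "(\<Union>i\<in>I. arcs_of (q i)) = E"
    and "int (card I) = total_exc V E"
  shows "perfect_paths V E (q ` I)"
proof -
  have ne: "arcs_of (q i) \<noteq> {}" if "i \<in> I" for i
    using assms(2)[OF that] by (cases "q i"; cases "tl (q i)") auto
  have "inj_on q I"
    using assms(3) ne by (fastforce simp: inj_on_def disjoint_family_on_def)
  then have "card (q ` I) = card I" by (rule card_image)
  moreover have "arcs_of xs \<inter> arcs_of ys = {}" if xy: "xs \<in> q ` I" "ys \<in> q ` I" "xs \<noteq> ys" for xs ys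
  proof -
    obtain i j where "i \<in> I" "j \<in> I" "xs = q i" "ys = q j" using xy by blast
    moreover from this have "i \<noteq> j" using xy(3) by auto
    ultimately show ?thesis using disjoint_family_onD[OF assms(3), of i j] by simp
  qed
  ultimately show ?thesis
    using assms(1,2,4,5) unfolding perfect_paths_def disjoint_family_on_def by simp
qed

text \<open>
  A vertex \<open>v \<in> T\<close> is the end of exactly one path of the perfect decomposition of \<open>E'\<close>; this path is
  prolonged by the arc \<open>(v, f v)\<close>.
\<close>

lemma perfect_paths_extend:
  assumes V: "finite V" and E': "E' \<subseteq> (V - W) \<times> (V - W)" and P: "perfect_paths (V - W) E' P"
    and T: "T \<subseteq> V - W" "f ` T \<subseteq> W" "\<And>v. v \<in> T \<Longrightarrow> exc E' v = -1"
    and p: "\<And>i. i < N \<Longrightarrow> distinct (p i) \<and> length (p i) \<ge> 2"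
      "disjoint_family_on (\<lambda>i. arcs_of (p i)) {..<N}"
    and E: "E = E' \<union> (\<Union>i<N. arcs_of (p i)) \<union> (\<lambda>v. (v, f v)) ` T"
    and disj: "E' \<inter> (\<Union>i<N. arcs_of (p i)) = {}"
      "(\<lambda>v. (v, f v)) ` T \<inter> (\<Union>i<N. arcs_of (p i)) = {}"
    and tot: "total_exc V E = total_exc (V - W) E' + int N"
  shows "\<exists>P. perfect_paths V E P"
proof -
  have fP: "finite P" and Pd: "\<And>xs. xs \<in> P \<Longrightarrow> distinct xs \<and> length xs \<ge> 2"
    and Pdj: "disjoint_family_on arcs_of P" and Pun: "(\<Union>xs\<in>P. arcs_of xs) = E'"
    and cP: "int (card P) = total_exc (V - W) E'"
    using P by (auto simp: perfect_paths_def)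
  have end1: "card {xs \<in> P. last xs = v} = 1" if "v \<in> T" for v
    using perfect_paths_ends[OF _ E' P, of v] V T that by auto
  have setP: "set xs \<subseteq> V - W" if "xs \<in> P" for xs
  proof
    fix z assume "z \<in> set xs"
    then obtain a where "a \<in> arcs_of xs" "fst a = z \<or> snd a = z"
      using vertex_in_arc[of z xs] Pd[OF \<open>xs \<in> P\<close>] by auto
    then show "z \<in> V - W" using Pun E' \<open>xs \<in> P\<close> by fastforce
  qed
  define g where "g xs = (if last xs \<in> T then xs @ [f (last xs)] else xs)" for xs
  define F where "F xs = (if last xs \<in> T then {(last xs, f (last xs))} else {})" for xs
  have arcs_g: "arcs_of (g xs) = arcs_of xs \<union> F xs" if "xs \<in> P" for xs
  proof -
    have "xs \<noteq> []" using Pd[OF that] by auto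
    then show ?thesis using arcs_of_append[of xs "[f (last xs)]"] by (simp add: g_def F_def)
  qed
  have FW: "F xs \<inter> E' = {}" for xs using E' T by (auto simp: F_def)
  have FF: "F xs \<inter> F ys = {}" if "xs \<in> P" "ys \<in> P" "xs \<noteq> ys" for xs ys
  proof (rule ccontr)
    assume "F xs \<inter> F ys \<noteq> {}"
    then have l: "last xs \<in> T" "last ys = last xs" by (auto simp: F_def split: if_splits)
    have "card {xs, ys} \<le> card {zs \<in> P. last zs = last xs}"
      using that l fP by (intro card_mono) auto
    then show False using end1[OF l(1)] that by simp
  qed
  \<comment> \<open>The disjoint sum keeps the linked paths and the prolonged paths apart, so that
    the number of indices is N + |P|.\<close>
  define I where "I = {..<N} <+> P"
  define q where "q = case_sum p g"
  have "perfect_paths V E (q ` I)"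
  proof (rule perfect_paths_family)
    show "finite I" using fP by (simp add: I_def)
    show "distinct (q i) \<and> length (q i) \<ge> 2" if "i \<in> I" for i
    proof (cases i)
      case (Inl j)
      then show ?thesis using that p by (auto simp: I_def q_def)
    next
      case (Inr xs)
      then have xs: "xs \<in> P" using that by (auto simp: I_def)
      have "f (last xs) \<notin> set xs" if "last xs \<in> T" using setP[OF xs] T that by auto
      then show ?thesis using Inr Pd[OF xs] by (auto simp: q_def g_def)
    qed
    have gp: "arcs_of (g xs) \<inter> arcs_of (p j) = {}" if "xs \<in> P" "j < N" for xs j
    proof -
      have "F xs \<subseteq> (\<lambda>v. (v, f v)) ` T" by (auto simp: F_def)
      then show ?thesis using disj that Pun by (fastforce simp: arcs_g)
    qed
    have gg: "arcs_of (g xs) \<inter> arcs_of (g ys) = {}" if "xs \<in> P" "ys \<in> P" "xs \<noteq> ys" for xs ys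
    proof -
      have "arcs_of xs \<inter> arcs_of ys = {}" using Pdj that by (auto simp: disjoint_family_on_def)
      moreover have "arcs_of xs \<subseteq> E'" "arcs_of ys \<subseteq> E'" using Pun that by auto
      ultimately show ?thesis using FF[OF that] FW[of xs] FW[of ys] that by (auto simp: arcs_g)
    qed
    show "disjoint_family_on (\<lambda>i. arcs_of (q i)) I"
    proof (unfold disjoint_family_on_def, intro ballI impI)
      fix i j assume ij: "i \<in> I" "j \<in> I" "i \<noteq> j"
      show "arcs_of (q i) \<inter> arcs_of (q j) = {}"
      proof (cases i; cases j)
        fix a b assume "i = Inl a" "j = Inl b"
        then show ?thesis using ij p(2) by (auto simp: I_def q_def disjoint_family_on_def)
      next
        fix a b assume "i = Inl a" "j = Inr b"
        then show ?thesis using ij gp[of b a] by (auto simp: I_def q_def Int_commute)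
      next
        fix a b assume "i = Inr a" "j = Inl b"
        then show ?thesis using ij gp[of a b] by (auto simp: I_def q_def)
      next
        fix a b assume "i = Inr a" "j = Inr b"
        then show ?thesis using ij gg[of a b] by (auto simp: I_def q_def)
      qed
    qed
    have "(\<Union>xs\<in>P. F xs) = (\<lambda>v. (v, f v)) ` T"
    proof
      show "(\<Union>xs\<in>P. F xs) \<subseteq> (\<lambda>v. (v, f v)) ` T" by (auto simp: F_def)
      show "(\<lambda>v. (v, f v)) ` T \<subseteq> (\<Union>xs\<in>P. F xs)"
      proof
        fix a assume "a \<in> (\<lambda>v. (v, f v)) ` T"
        then obtain v where v: "v \<in> T" "a = (v, f v)" by auto
        have "{xs \<in> P. last xs = v} \<noteq> {}" using end1[OF v(1)] by (metis card.empty zero_neq_one)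
        then obtain xs where "xs \<in> P" "last xs = v" by auto
        then show "a \<in> (\<Union>xs\<in>P. F xs)" using v by (auto simp: F_def)
      qed
    qed
    moreover have "(\<Union>xs\<in>P. arcs_of (g xs)) = (\<Union>xs\<in>P. arcs_of xs) \<union> (\<Union>xs\<in>P. F xs)"
      using arcs_g by auto
    ultimately have "(\<Union>xs\<in>P. arcs_of (g xs)) = E' \<union> (\<lambda>v. (v, f v)) ` T"
      using Pun by simp
    moreover have "(\<Union>i\<in>I. arcs_of (q i)) = (\<Union>i<N. arcs_of (p i)) \<union> (\<Union>xs\<in>P. arcs_of (g xs))"
      by (auto simp: I_def q_def)
    ultimately show "(\<Union>i\<in>I. arcs_of (q i)) = E" using E by auto
    show "int (card I) = total_exc V E"
      using tot cP fP by (simp add: I_def card_Plus)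
  qed
  then show ?thesis by blast
qed

text \<open>Take a largest admissible even subset. If it stayed 2 K or more below t, then two
  further elements could be added; two are left, as the total exceeds t + K. Adding in pairs
  preserves parity and costs the factor 2.\<close>

lemma ex_even_subset_sum:
  fixes f :: "'a \<Rightarrow> nat" and t K :: real
  assumes A: "finite A" "\<And>a. a \<in> A \<Longrightarrow> real (f a) \<le> K" and t: "0 \<le> t" "t + K < sum f A" and K: "0 \<le> K"
  shows "\<exists>B\<subseteq>A. even (card B) \<and> real (sum f B) \<le> t \<and> t < sum f B + 2 * K"
proof -
  define Q where "Q B \<longleftrightarrow> B \<subseteq> A \<and> even (card B) \<and> real (sum f B) \<le> t" for B
  have "Q {}" using t by (simp add: Q_def)
  moreover have "\<forall>B. Q B \<longrightarrow> card B < Suc (card A)"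
    using A by (auto simp: Q_def less_Suc_eq_le card_mono)
  ultimately obtain B where B: "Q B" "\<And>B'. Q B' \<Longrightarrow> card B' \<le> card B"
    using ex_has_greatest_nat[of Q "{}" card "Suc (card A)"] by blast
  have BA: "B \<subseteq> A" "finite B" using B A finite_subset by (auto simp: Q_def)
  have sAB: "sum f A = sum f B + sum f (A - B)"
    using A BA by (simp add: sum.subset_diff add.commute)
  have "t < sum f B + 2 * K"
  proof (rule ccontr)
    assume *: "\<not> ?thesis"
    have "\<not> card (A - B) \<le> 1"
    proof
      assume "card (A - B) \<le> 1"
      moreover have "real (sum f (A - B)) \<le> (\<Sum>a\<in>A - B. K)"
        unfolding of_nat_sum using A by (intro sum_mono) auto
      ultimately have "real (sum f (A - B)) \<le> K"
        using K mult_right_mono[of "real (card (A - B))" 1 K] by simp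
      then show False using sAB B t by (simp add: Q_def)
    qed
    then have "2 \<le> card (A - B)" by linarith
    then obtain Y where Y: "Y \<subseteq> A - B" "card Y = 2" by (meson obtain_subset_with_card_n)
    have fY: "finite Y" using Y by (metis card.infinite zero_neq_numeral)
    have "real (sum f Y) \<le> (\<Sum>a\<in>Y. K)" unfolding of_nat_sum using A Y by (intro sum_mono) auto
    then have "real (sum f Y) \<le> 2 * K" using Y by simp
    moreover have "B \<inter> Y = {}" using Y by auto
    then have "sum f (B \<union> Y) = sum f B + sum f Y" "card (B \<union> Y) = card B + 2"
      using Y(2) fY BA by (simp_all add: sum.union_disjoint card_Un_disjoint)
    ultimately have "Q (B \<union> Y)" using * B Y by (auto simp: Q_def)
    then show False using B(2)[of "B \<union> Y"] \<open>card (B \<union> Y) = card B + 2\<close> by simp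
  qed
  then show ?thesis using B by (auto simp: Q_def)
qed

section \<open>The reduction\<close>

text \<open>The case treated in the overview. Here \<open>s v\<close> is |ex(v)|, \<open>R\<close>
  the set of reserved vertices, \<open>F\<close> the set of arcs (v, f v), and \<open>Q\<close> the
  set of arcs of the linked paths, of which \<open>b v\<close> start and \<open>e v\<close> end at
  v.\<close>

lemma unbalanced_reduction:
  fixes V :: "'a set" and E :: "('a \<times> 'a) set" and C \<alpha> \<beta> \<epsilon> lam :: real
  assumes V: "finite V" "card V = n" "even n" and E: "E \<subseteq> V \<times> V"
    and anti: "\<And>a b. (a, b) \<in> E \<Longrightarrow> (b, a) \<notin> E"
    and deg: "\<And>v. v \<in> V \<Longrightarrow> real (out_deg E v + in_deg E v) \<ge> (1 - \<epsilon>) * n"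
    and exc: "\<And>v. v \<in> V \<Longrightarrow> 1 \<le> \<bar>exc E v\<bar> \<and> real_of_int \<bar>exc E v\<bar> \<le> \<alpha> * n"
    and tot: "real_of_int (total_exc V E) \<ge> C * n"
    and imb: "real (card {v \<in> V. exc E v > 0}) > card {v \<in> V. exc E v < 0} + 2 * lam * n"
    and lam: "0 < lam" "lam \<le> 1 / 1000" and eps: "0 < \<epsilon>" "\<epsilon> \<le> lam / 1000"
    and al: "0 < \<alpha>" "\<alpha> \<le> \<epsilon>\<^sup>2 / 1000" and be: "0 < \<beta>" "\<beta> \<le> \<epsilon>\<^sup>2 / 1000"
    and C: "C > 0" "1 / C \<le> \<beta>" and n: "n > 0" "1 / real n \<le> 1 / C"
    and noperf: "\<not> (\<exists>P. perfect_paths V E P)"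
  shows "\<exists>V' E'. V' \<subseteq> V \<and> E' \<subseteq> E \<and> E' \<subseteq> V' \<times> V' \<and> \<not> (\<exists>P. perfect_paths V' E' P) \<and>
    real (card V') \<ge> (1 - \<beta>) * n \<and> even (card V') \<and>
    (\<forall>v\<in>V'. real (out_deg E' v + in_deg E' v) \<ge> (1 - 8 * \<epsilon>) * n) \<and>
    (\<forall>v\<in>V'. 1 \<le> \<bar>exc E' v\<bar> \<and> real_of_int \<bar>exc E' v\<bar> \<le> \<alpha> * n) \<and>
    real_of_int (total_exc V' E') \<ge> lam * C * n / 32 \<and>
    \<bar>real (card {v \<in> V'. exc E' v < 0}) - real (card {v \<in> V'. exc E' v > 0})\<bar> \<le> 2 * lam * card V'"
proof -
  define s where "s v = nat \<bar>exc E v\<bar>" for v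
  define Up where "Up = {v \<in> V. exc E v > 0}"
  define Um where "Um = {v \<in> V. exc E v < 0}"
  have fE: "finite E" using E V finite_subset by blast
  have sUp: "exc E v = int (s v)" if "v \<in> Up" for v using that by (simp add: s_def Up_def)
  have sUm: "exc E v = - int (s v)" if "v \<in> Um" for v using that by (simp add: s_def Um_def)
  have s1: "1 \<le> s v" "real (s v) \<le> \<alpha> * n" if "v \<in> V" for v
    using exc[OF that] by (auto simp: s_def)
  have VU: "V = Up \<union> Um" "Up \<inter> Um = {}" using exc by (fastforce simp: Up_def Um_def)+
  have fU: "finite Up" "finite Um" using V by (auto simp: Up_def Um_def)
  have cU: "n = card Up + card Um" using VU V fU by (metis card_Un_disjoint)
  have nn: "0 < real n" using n by simp

  \<comment> \<open>Numerical consequences of the hierarchy\<close>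
  have e2: "\<epsilon>\<^sup>2 \<le> \<epsilon> / 1000000"
    using eps lam mult_left_mono[of \<epsilon> "1 / 1000000" \<epsilon>] by (simp add: power2_eq_square)
  have Cbig: "C \<ge> 1000 / \<epsilon>\<^sup>2"
  proof -
    have "1 / C \<le> \<epsilon>\<^sup>2 / 1000" using C be by linarith
    then show ?thesis using C eps by (simp add: field_simps)
  qed
  have Ceps: "C * \<epsilon> \<ge> 1000"
  proof -
    have "C * \<epsilon>\<^sup>2 \<ge> 1000" using Cbig eps by (simp add: field_simps)
    moreover have "C * \<epsilon>\<^sup>2 \<le> C * \<epsilon>" using C e2 eps by (intro mult_left_mono) auto
    ultimately show ?thesis by linarith
  qed
  have Clam: "C * lam \<ge> 1000"
    using Ceps eps lam C mult_left_mono[of \<epsilon> lam C] by linarith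
  have C4: "C \<ge> 1000"
  proof -
    have "C * lam \<le> C * 1" using C lam by (intro mult_left_mono) auto
    then show ?thesis using Clam by simp
  qed
  have nC: "real n \<ge> C" using n C by (simp add: field_simps)
  have en: "\<epsilon> * n \<ge> 1000"
  proof -
    have "\<epsilon> * C \<le> \<epsilon> * n" using nC eps by (intro mult_left_mono) auto
    then show ?thesis using Ceps by (simp add: mult.commute)
  qed
  have aln: "\<alpha> * n \<le> \<epsilon> * n / 1000" and ben: "\<beta> * n \<le> \<epsilon> * n / 1000"
    using al be e2 eps nn mult_right_mono[of \<alpha> "\<epsilon> / 1000" "real n"] mult_right_mono[of \<beta> "\<epsilon> / 1000" "real n"]
    by simp_all
  have eln: "\<epsilon> * n \<le> lam * n / 1000"
    using mult_right_mono[OF eps(2), of "real n"] by simp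
  have lamn: "lam * n \<le> n / 1000" using mult_right_mono[OF lam(2), of "real n"] by simp
  have Cln: "lam * C * n \<ge> 1000 * n" using mult_right_mono[OF Clam, of "real n"] by (simp add: mult_ac)

  \<comment> \<open>The two degrees sum to at least (1 - eps) n and differ by at most alpha * n <=
    eps * n.\<close>
  have halfdeg: "real (out_deg E v) \<ge> (1/2 - \<epsilon>) * n" "real (in_deg E v) \<ge> (1/2 - \<epsilon>) * n"
    if "v \<in> V" for v
  proof -
    have "real_of_int (exc E v) = real (out_deg E v) - real (in_deg E v)" by (simp add: exc_def)
    moreover have "\<bar>real_of_int (exc E v)\<bar> \<le> \<alpha> * n" using exc[OF that] by simp
    ultimately show "real (out_deg E v) \<ge> (1/2 - \<epsilon>) * n" "real (in_deg E v) \<ge> (1/2 - \<epsilon>) * n"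
      using deg[OF that] aln by (auto simp: algebra_simps)
  qed
  have totUp: "total_exc V E = int (sum s Up)"
  proof -
    have "total_exc V E = (\<Sum>v\<in>Up. max (exc E v) 0) + (\<Sum>v\<in>Um. max (exc E v) 0)"
      unfolding total_exc_def VU(1) using VU(2) fU by (intro sum.union_disjoint) auto
    also have "(\<Sum>v\<in>Um. max (exc E v) 0) = 0" by (intro sum.neutral) (auto simp: Um_def)
    also have "(\<Sum>v\<in>Up. max (exc E v) 0) = (\<Sum>v\<in>Up. int (s v))"
      by (intro sum.cong) (auto simp: sUp)
    finally show ?thesis by simp
  qed
  have totUm: "total_exc V E = int (sum s Um)"
  proof -
    have "total_exc V E = (\<Sum>v\<in>V. max (- exc E v) 0)" by (rule total_exc_negative[OF V(1) E])
    also have "\<dots> = (\<Sum>v\<in>Up. max (- exc E v) 0) + (\<Sum>v\<in>Um. max (- exc E v) 0)"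
      unfolding VU(1) using VU(2) fU by (intro sum.union_disjoint) auto
    also have "(\<Sum>v\<in>Up. max (- exc E v) 0) = 0" by (intro sum.neutral) (auto simp: Up_def)
    also have "(\<Sum>v\<in>Um. max (- exc E v) 0) = (\<Sum>v\<in>Um. int (s v))"
      by (intro sum.cong) (auto simp: sUm)
    finally show ?thesis by simp
  qed
  have eqUU: "sum s Up = sum s Um" using totUp totUm by (metis of_nat_eq_iff)
  have CUp: "real (sum s Up) \<ge> C * n" using tot totUp by simp
  then have CUm: "real (sum s Um) \<ge> C * n" unfolding eqUU .

  \<comment> \<open>The imbalance, the set \<open>W\<close> and the reserve \<open>R\<close>\<close>
  define d where "d = real (card Up) - real (card Um)"
  have ln: "0 < lam * n" and alpos: "0 < \<alpha> * n" using lam al nn by auto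
  have d: "d > 2 * (lam * n)" "d \<le> n"
    using imb cU unfolding d_def Up_def Um_def by (simp_all add: mult.assoc)
  \<comment> \<open>The target for |S|. Half of d would balance the classes exactly; the slack lam *
    n / 2 pays for the reserve and for the degree defect when in-neighbours are chosen, and leaves a
    final difference of about d - 2 t = lam * n.\<close>
  define t where "t = d / 2 - lam * n / 2"

  obtain W where W: "W \<subseteq> Um" "even (card W)" "real (sum s W) \<le> t" "t < sum s W + 2 * (\<alpha> * n)"
    and WC: "\<And>w. w \<in> W \<Longrightarrow> C \<le> s w"
  proof -
    \<comment> \<open>At most n/2 vertices lie in \<open>Um\<close>, so those with excess below C
      carry at most C n / 2, half of the guaranteed total.\<close>
    define A where "A = {v \<in> Um. C \<le> s v}"
    have "sum s Um = sum s A + sum s (Um - A)"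
      using sum.subset_diff[of A Um s] fU by (auto simp: A_def)
    moreover have "real (sum s (Um - A)) \<le> (\<Sum>v\<in>Um - A. C)"
      unfolding of_nat_sum by (intro sum_mono) (auto simp: A_def)
    moreover have "(\<Sum>v\<in>Um - A. C) \<le> C * (n / 2)"
    proof -
      have "card (Um - A) \<le> card Um" using fU by (intro card_mono) auto
      moreover have "2 * real (card Um) \<le> n"
        using d(1) lam nn cU ln unfolding d_def by linarith
      ultimately have "real (card (Um - A)) \<le> n / 2" by linarith
      then show ?thesis using C mult_left_mono[of "real (card (Um - A))" "n / 2" C]
        by (simp add: mult.commute)
    qed
    ultimately have "real (sum s A) \<ge> C * n / 2" using CUm by simp
    moreover have "C * n \<ge> 1000 * n" using C4 nn by simp
    ultimately have big: "real (sum s A) \<ge> 500 * n" by linarith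
    have "\<exists>B\<subseteq>A. even (card B) \<and> real (sum s B) \<le> t \<and> t < sum s B + 2 * (\<alpha> * n)"
    proof (rule ex_even_subset_sum)
      show "finite A" using fU by (simp add: A_def)
      show "real (s a) \<le> \<alpha> * n" if "a \<in> A" for a using s1 that VU by (auto simp: A_def)
      show "0 \<le> t" using d ln unfolding t_def by linarith
      show "0 \<le> \<alpha> * n" using al by simp
      show "t + \<alpha> * n < sum s A"
        using big d aln eln lamn nn lam ln unfolding t_def by linarith
    qed
    then show ?thesis using that by (auto simp: A_def)
  qed
  have WV: "W \<subseteq> V" "finite W" using W VU fU finite_subset by auto
  have cW: "real (card W) \<le> \<beta> * n"
  proof -
    have "(\<Sum>w\<in>W. C) \<le> real (sum s W)" unfolding of_nat_sum by (intro sum_mono WC)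
    also have "\<dots> \<le> n" using W(3) d lam nn ln unfolding t_def by linarith
    finally have "C * card W \<le> n" by (simp add: mult.commute)
    then have "real (card W) \<le> (1 / C) * n" using C by (simp add: field_simps)
    also have "\<dots> \<le> \<beta> * n" using C by (intro mult_right_mono) auto
    finally show ?thesis .
  qed

  obtain R where R: "R \<subseteq> Up" "real (card R) \<le> lam * n / 4" "real (sum s R) \<ge> lam * C * n / 8"
  proof -
    \<comment> \<open>Rounding down costs at most half, since lam * n is large. By averaging, k
      vertices carry at least k / n of the total excess, hence at least lam * C * n / 8.\<close>
    define k where "k = nat \<lfloor>lam * n / 4\<rfloor>"
    have k: "real k \<le> lam * n / 4" "real k \<ge> lam * n / 8"
    proof -
      have "real k = real_of_int \<lfloor>lam * n / 4\<rfloor>" using ln by (simp add: k_def)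
      then show "real k \<le> lam * n / 4" "real k \<ge> lam * n / 8" using eln en by linarith+
    qed
    have "real k \<le> real (card Up)" using k lamn d cU lam ln nn unfolding d_def by linarith
    then obtain R where R: "R \<subseteq> Up" "card R = k" "k * sum s Up \<le> card Up * sum s R"
      using ex_large_subset_sum[OF fU(1), of k s] by auto
    have "lam * n / 8 * (C * n) \<le> real k * real (sum s Up)"
      using k CUp C lam by (intro mult_mono) auto
    also have "\<dots> \<le> real (card Up) * real (sum s R)"
      using of_nat_mono[OF R(3), where 'a = real] by simp
    also have "\<dots> \<le> n * real (sum s R)" using cU by (intro mult_right_mono of_nat_0_le_iff) auto
    finally have "real (sum s R) \<ge> lam * C * n / 8" using nn by (simp add: field_simps)
    then show ?thesis using that R k by auto
  qed
  have fR: "finite R" using R fU finite_subset by blast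

  \<comment> \<open>Private in-neighbours of the vertices of \<open>W\<close>\<close>
  obtain T where T: "\<And>w. w \<in> W \<Longrightarrow> T w \<subseteq> {v \<in> Up - R. (v, w) \<in> E}" "\<And>w. w \<in> W \<Longrightarrow> card (T w) = s w"
    "disjoint_family_on T W"
  proof -
    have "finite {v \<in> Up - R. (v, w) \<in> E} \<and> sum s W \<le> card {v \<in> Up - R. (v, w) \<in> E}" if "w \<in> W" for w
    proof
      \<comment> \<open>Outside \<open>R\<close> and \<open>Um\<close> there remain at least (1/2 -
        eps) n - lam * n / 4 - (n/2 - d/2) in-neighbours, which is at least t.\<close>
      have "in_deg E w \<le> card ({v \<in> Up - R. (v, w) \<in> E} \<union> R \<union> Um)"
        unfolding in_deg_alt using fU fR E VU by (intro card_mono) auto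
      also have "\<dots> \<le> card {v \<in> Up - R. (v, w) \<in> E} + card R + card Um"
        by (rule order_trans[OF card_Un_le] add_mono order_refl)+
      finally have "real (in_deg E w) \<le> card {v \<in> Up - R. (v, w) \<in> E} + card R + card Um" by linarith
      moreover have "real (card Um) = n / 2 - d / 2" using cU by (simp add: d_def field_simps)
      ultimately have "real (card {v \<in> Up - R. (v, w) \<in> E}) \<ge> t"
        using halfdeg(2)[of w] that WV R(2) eln unfolding t_def by (auto simp: algebra_simps)
      then show "sum s W \<le> card {v \<in> Up - R. (v, w) \<in> E}" using W(3) by linarith
    qed (use fU in simp)
    then obtain T where "\<forall>w\<in>W. T w \<subseteq> {v \<in> Up - R. (v, w) \<in> E} \<and> card (T w) = s w" "disjoint_family_on T W"
      using ex_disjoint_representatives[OF WV(2), of "\<lambda>w. {v \<in> Up - R. (v, w) \<in> E}" s] by blast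
    then show ?thesis using that by blast
  qed
  define S where "S = (\<Union>w\<in>W. T w)"
  have SUp: "S \<subseteq> Up - R" using T(1) by (auto simp: S_def)
  have fS: "finite S" using SUp fU finite_subset by blast
  have SW: "S \<inter> W = {}" using SUp W(1) VU by auto
  have fT: "finite (T w)" if "w \<in> W" for w using that fS by (auto simp: S_def intro: finite_subset)
  have cS: "card S = sum s W"
    unfolding S_def using WV fT T(2,3)
    by (subst card_UN_disjoint) (auto simp: disjoint_family_on_def)
  obtain f where f: "\<And>v. v \<in> S \<Longrightarrow> f v \<in> W \<and> v \<in> T (f v)"
    using S_def by (metis UN_E)
  have Tf: "T w = {v \<in> S. f v = w}" if "w \<in> W" for w
    using f T(3) that by (auto simp: S_def disjoint_family_on_def)
  define F where "F = (\<lambda>v. (v, f v)) ` S"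
  have FE: "F \<subseteq> E" using f T(1) by (auto simp: F_def)
  have fF: "finite F" using fS by (simp add: F_def)
  have outF: "out_deg F v = of_bool (v \<in> S)" for v
  proof -
    have "{a \<in> F. fst a = v} = (if v \<in> S then {(v, f v)} else {})" by (auto simp: F_def)
    then show ?thesis by (simp add: out_deg_def)
  qed
  have inF: "in_deg F w = (if w \<in> W then s w else 0)" for w
  proof -
    have "{a \<in> F. snd a = w} = (\<lambda>v. (v, f v)) ` {v \<in> S. f v = w}" by (auto simp: F_def)
    then have "in_deg F w = card {v \<in> S. f v = w}" by (simp add: in_deg_def card_image inj_on_def)
    moreover have "card {v \<in> S. f v = w} = 0" if "w \<notin> W"
      using f that by (metis (mono_tags, lifting) card.empty empty_Collect_eq)
    moreover have "card {v \<in> S. f v = w} = s w" if "w \<in> W"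
      using T(2)[OF that] unfolding Tf[OF that] .
    ultimately show ?thesis by simp
  qed

  have halfW: "W \<inter> Up = {}" using W(1) VU by auto
  obtain Sg where Sg: "finite Sg" "\<forall>xs\<in>Sg. distinct xs \<and> 3 \<le> length xs \<and> length xs \<le> 4 \<and>
      hd xs \<notin> W \<and> last xs \<notin> W \<and> set xs \<inter> W \<noteq> {}" "disjoint_family_on arcs_of Sg"
    "(\<Union>xs\<in>Sg. arcs_of xs) = {a \<in> E - F. fst a \<in> W \<or> snd a \<in> W}"
  proof -
    let ?H = "E - F"
    have "\<exists>S. finite S \<and> (\<forall>xs\<in>S. distinct xs \<and> 3 \<le> length xs \<and> length xs \<le> 4 \<and>
      hd xs \<notin> W \<and> last xs \<notin> W \<and> set xs \<inter> W \<noteq> {}) \<and> disjoint_family_on arcs_of S \<and>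
      (\<Union>xs\<in>S. arcs_of xs) = {a \<in> ?H. fst a \<in> W \<or> snd a \<in> W}"
    proof (rule ex_segments)
      show "finite ?H" using fE by simp
      show "(b, a) \<notin> ?H" if "(a, b) \<in> ?H" for a b using anti that by auto
      fix w assume w: "w \<in> W"
      have "exc F w = - int (s w)"
        using w SW by (auto simp: exc_def outF inF)
      moreover have "exc E w = - int (s w)" using sUm w W by auto
      ultimately show "exc ?H w = 0" using exc_Diff[OF fE FE] by simp
      let ?I = "{a \<in> ?H \<inter> W \<times> W. fst a = w \<or> snd a = w}"
      have "card ?I \<le> card W"
      proof (rule card_inj_on_le[where f = "\<lambda>a. if fst a = w then snd a else fst a"])
        show "inj_on (\<lambda>a. if fst a = w then snd a else fst a) ?I"
        proof (rule inj_onI)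
          fix a b assume "a \<in> ?I" "b \<in> ?I"
            "(if fst a = w then snd a else fst a) = (if fst b = w then snd b else fst b)"
          then show "a = b" using anti by (cases a; cases b) (auto split: if_splits)
        qed
      qed (use WV in auto)
      then have I: "real (card ?I) \<le> \<beta> * n" using cW by linarith
      have wV: "w \<in> V" using w WV by auto
      have "out_deg E w \<le> card ({a \<in> ?H. fst a = w \<and> snd a \<notin> W} \<union> Pair w ` W)"
        unfolding out_deg_def using fE WV w SW by (intro card_mono) (auto simp: F_def)
      also have "\<dots> \<le> card {a \<in> ?H. fst a = w \<and> snd a \<notin> W} + card W"
        by (rule order_trans[OF card_Un_le]) (simp add: card_image_le WV)
      finally have o: "real (out_deg E w) \<le> card {a \<in> ?H. fst a = w \<and> snd a \<notin> W} + card W" by linarith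
      have "in_deg E w \<le> card ({a \<in> ?H. snd a = w \<and> fst a \<notin> W} \<union> {a \<in> F. snd a = w} \<union> (\<lambda>v. (v, w)) ` W)"
        unfolding in_deg_def using fE fF WV by (intro card_mono) auto
      also have "\<dots> \<le> card {a \<in> ?H. snd a = w \<and> fst a \<notin> W} + card {a \<in> F. snd a = w} + card ((\<lambda>v. (v, w)) ` W)"
        by (rule order_trans[OF card_Un_le] add_mono order_refl)+
      also have "\<dots> \<le> card {a \<in> ?H. snd a = w \<and> fst a \<notin> W} + s w + card W"
        using inF[of w] w by (intro add_mono) (auto simp: in_deg_def card_image_le WV)
      finally have i: "real (in_deg E w) \<le> card {a \<in> ?H. snd a = w \<and> fst a \<notin> W} + s w + card W"
        by linarith
      have h: "(1/2 - \<epsilon>) * n \<ge> n / 4" using eln lamn by (simp add: algebra_simps)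
      \<comment> \<open>The outer degrees of w stay at least n/4 - alpha * n - beta * n, while at
        most |W| <= beta * n arcs at w are inner.\<close>
      have "\<beta> * n < n / 4 - \<alpha> * n - \<beta> * n" using ben aln eln lamn nn by linarith
      then have "real (card ?I) < card {a \<in> ?H. fst a = w \<and> snd a \<notin> W}"
        "real (card ?I) < card {a \<in> ?H. snd a = w \<and> fst a \<notin> W}"
        using I o i h halfdeg[OF wV] s1(2)[OF wV] cW al nn alpos by linarith+
      then show "card ?I < card {a \<in> ?H. fst a = w \<and> snd a \<notin> W} \<and>
        card ?I < card {a \<in> ?H. snd a = w \<and> fst a \<notin> W}" by simp
    qed
    then show ?thesis using that by blast
  qed

  \<comment> \<open>Multiplicities of the starts and ends of the linked paths\<close>
  have RV: "R \<inter> S = {}" "R \<union> S \<subseteq> Up" using SUp R by auto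
  \<comment> \<open>These are the 5 n additional starts that the linkage requires. The cap
    \<open>s v - 1\<close> leaves positive excess at every vertex of \<open>R\<close>.\<close>
  obtain bR where bR: "\<And>v. bR v \<le> s v - 1" "\<And>v. v \<notin> R \<Longrightarrow> bR v = 0" "sum bR R = 5 * n"
  proof -
    have "real (sum s R) \<le> real (\<Sum>v\<in>R. s v - 1) + card R"
    proof -
      have "sum s R \<le> (\<Sum>v\<in>R. (s v - 1) + 1)" by (intro sum_mono) auto
      also have "\<dots> = (\<Sum>v\<in>R. s v - 1) + card R" by (simp add: sum_Suc)
      finally show ?thesis by linarith
    qed
    then have "5 * real n \<le> real (\<Sum>v\<in>R. s v - 1)" using R(2,3) Cln lamn nn by linarith
    then have "5 * n \<le> (\<Sum>v\<in>R. s v - 1)" by linarith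
    then show ?thesis using ex_bounded_function_with_sum[OF fR, of "5 * n" "\<lambda>v. s v - 1"] that by blast
  qed
  define b where "b v = (if v \<in> S then s v else bR v)" for v
  define N where "N = sum s S + 5 * n"
  have b0: "b v = 0" if "v \<notin> R \<union> S" for v using that bR by (auto simp: b_def)
  have bs: "b v \<le> s v" for v using bR(1)[of v] by (auto simp: b_def)
  have sumb: "sum b V = N"
  proof -
    have "sum b V = sum b (R \<union> S)"
      using V b0 RV VU by (intro sum.mono_neutral_right) auto
    also have "\<dots> = sum b R + sum b S" using fR fS RV by (intro sum.union_disjoint) auto
    also have "sum b R = sum bR R" using RV by (intro sum.cong) (auto simp: b_def)
    also have "sum b S = sum s S" by (simp add: b_def)
    finally show ?thesis using bR by (simp add: N_def)
  qed
  \<comment> \<open>The total excess of \<open>Um\<close> equals that of \<open>Up\<close> and is at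
    least \<open>sum s S + 7 * n\<close>. Here \<open>W\<close> takes at most n, and keeping 1 at
    each vertex costs at most n; the remaining capacity is at least N.\<close>
  obtain e where e: "\<And>v. e v \<le> s v - 1" "\<And>v. v \<notin> Um - W \<Longrightarrow> e v = 0" "sum e (Um - W) = N"
  proof -
    have "sum s (R \<union> S) \<le> sum s Up" using fU RV by (intro sum_mono2) auto
    then have "sum s R + sum s S \<le> sum s Up" using fR fS RV by (simp add: sum.union_disjoint)
    moreover have "real (sum s W) \<le> n"
      using W(3) d lam nn ln unfolding t_def by linarith
    moreover have "sum s Um = sum s W + sum s (Um - W)"
      using sum.subset_diff[of W Um s] fU W by simp
    moreover have "sum s (Um - W) \<le> (\<Sum>v\<in>Um - W. s v - 1) + n"
    proof -
      have "sum s (Um - W) \<le> (\<Sum>v\<in>Um - W. (s v - 1) + 1)" by (intro sum_mono) auto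
      also have "\<dots> = (\<Sum>v\<in>Um - W. s v - 1) + card (Um - W)" by (simp add: sum_Suc)
      also have "card (Um - W) \<le> n" using cU card_mono[of Um "Um - W"] fU by auto
      finally show ?thesis by simp
    qed
    moreover have "real (sum s R) \<ge> 7 * n" using R(3) Cln nn by linarith
    then have "sum s R \<ge> 7 * n" by linarith
    ultimately have "N \<le> (\<Sum>v\<in>Um - W. s v - 1)" using eqUU unfolding N_def by linarith
    then show ?thesis
      using ex_bounded_function_with_sum[of "Um - W" N "\<lambda>v. s v - 1"] fU that by blast
  qed
  have sume: "sum e V = N"
  proof -
    have "sum e V = sum e (Um - W)" using V e VU by (intro sum.mono_neutral_right) auto
    then show ?thesis using e by simp
  qed
  obtain r where r: "\<forall>i<N. r i \<in> V" "\<forall>v. card {i. i < N \<and> r i = v} = b v"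
    using ex_function_with_fibre_sizes[OF V(1) sumb] b0 RV VU by blast
  obtain u where u: "\<forall>i<N. u i \<in> V" "\<forall>v. card {i. i < N \<and> u i = v} = e v"
    using ex_function_with_fibre_sizes[OF V(1) sume] e(2) VU by blast
  have rU: "r i \<in> Up" if "i < N" for i
  proof (rule ccontr)
    assume "r i \<notin> Up"
    then have "b (r i) = 0" using b0[of "r i"] RV by auto
    then have "card {j. j < N \<and> r j = r i} = 0" using r(2) by simp
    then show False using that by auto
  qed
  have uU: "u i \<in> Um - W" if "i < N" for i
  proof (rule ccontr)
    assume "u i \<notin> Um - W"
    then have "e (u i) = 0" using e(2) by blast
    then have "card {j. j < N \<and> u j = u i} = 0" using u(2) by simp
    then show False using that by auto
  qed

  \<comment> \<open>The interpretation below introduces facts \<open>V\<close> and \<open>W\<close>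
    of its own; the primed names keep the present ones accessible.\<close>
  note W' = W and V' = V

  interpret linkage V W E n N \<epsilon> r u
  proof
    show "(b, a) \<notin> E" if "(a, b) \<in> E" for a b using anti that .
    show "\<epsilon> \<le> 1 / 1000" using eps lam by simp
    show "20 \<le> \<epsilon> * n" using en by simp
    show "5 * n \<le> N" by (simp add: N_def)
    \<comment> \<open>This gives N <= alpha * n^2, and 8 alpha + 24 beta <= 32 eps^2 / 1000.\<close>
    have "real N \<le> (\<Sum>v\<in>V. \<alpha> * n)"
      unfolding sumb [symmetric] of_nat_sum
      using s1(2) bs by (intro sum_mono) (meson of_nat_mono order_trans)
    also have "\<dots> = \<alpha> * n\<^sup>2" using V by (simp add: power2_eq_square)
    finally have "8 * real N \<le> 8 * (\<alpha> * n\<^sup>2)" by simp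
    moreover have "24 * n * real (card W) \<le> 24 * (\<beta> * n\<^sup>2)"
      using mult_left_mono[OF cW, of "24 * n"] by (simp add: power2_eq_square mult_ac)
    moreover have "\<alpha> * n\<^sup>2 \<le> \<epsilon>\<^sup>2 / 1000 * n\<^sup>2" "\<beta> * n\<^sup>2 \<le> \<epsilon>\<^sup>2 / 1000 * n\<^sup>2"
      by (rule mult_right_mono, use al be in simp, simp)+
    moreover have "0 \<le> \<epsilon>\<^sup>2 * n\<^sup>2" by simp
    ultimately show "8 * real N + real (24 * n * card W) \<le> \<epsilon>\<^sup>2 * real (n\<^sup>2)"
      by simp
    show "r i \<in> V - W" "u i \<in> V - W" "r i \<noteq> u i" if "i < N" for i
      using rU[OF that] uU[OF that] VU halfW by auto
    fix v
    have le: "real x \<le> \<alpha> * n" if "x \<le> s v" "v \<notin> V \<Longrightarrow> x = 0" for x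
    proof (cases "v \<in> V")
      case True
      then show ?thesis using s1(2)[OF True] that(1) by linarith
    next
      case False
      then show ?thesis using that(2) alpos by simp
    qed
    have "real (b v) \<le> \<alpha> * n"
      using b0[of v] RV VU(1) by (intro le bs) blast
    moreover have "real (e v) \<le> \<alpha> * n"
      using e(1)[of v] e(2)[of v] VU(1) by (intro le) auto
    ultimately
    show "real (card {i. i < N \<and> r i = v} + card {i. i < N \<and> u i = v}) \<le> \<epsilon> * n"
      using r(2) u(2) aln en by simp
  qed (use V E halfdeg WV eps in auto)

  have SgE: "(\<Union>xs\<in>Sg. arcs_of xs) \<subseteq> {a \<in> E. meets W a}"
    unfolding Sg(4) by (auto simp: meets_def)
  have Sg': "distinct xs \<and> 3 \<le> length xs \<and> length xs \<le> 4 \<and>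
      hd xs \<notin> W \<and> last xs \<notin> W \<and> set xs \<inter> W \<noteq> {}" if "xs \<in> Sg" for xs
    using Sg(2) that by blast
  obtain p where p: "\<forall>i<N. distinct (p i) \<and> length (p i) \<ge> 2 \<and> hd (p i) = r i \<and> last (p i) = u i \<and>
      arcs_of (p i) \<subseteq> E"
    "disjoint_family_on (\<lambda>i. arcs_of (p i)) {..<N}"
    "(\<Union>i<N. {a \<in> arcs_of (p i). meets W a}) = (\<Union>xs\<in>Sg. arcs_of xs)"
    "\<forall>v\<in>V - W. real (out_deg (\<Union>i<N. arcs_of (p i)) v) \<le> 3 * \<epsilon> * n \<and>
      real (in_deg (\<Union>i<N. arcs_of (p i)) v) \<le> 3 * \<epsilon> * n"
    by (insert ex_linkage[OF Sg(1) Sg' Sg(3) SgE], drule meta_mp, assumption, elim exE conjE)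
      (rule that; assumption)

  \<comment> \<open>The reduced arc set and its excesses\<close>
  define Q where "Q = (\<Union>i<N. arcs_of (p i))"
  define E' where "E' = E - (Q \<union> F)"
  have QE: "Q \<subseteq> E" using p by (auto simp: Q_def)
  \<comment> \<open>So every arc at \<open>W\<close> lies in \<open>Q\<close> or in
    \<open>F\<close>, and \<open>E'\<close> lives on V - W.\<close>
  have QW: "{a \<in> Q. meets W a} = {a \<in> E - F. meets W a}"
    using p(3) Sg(4) by (auto simp: Q_def meets_def)
  have FW: "meets W a" if "a \<in> F" for a using that f by (auto simp: F_def meets_def)
  have QF: "Q \<inter> F = {}" using QW FW by blast
  have fQ: "finite Q" by (simp add: Q_def)
  have E'V: "E' \<subseteq> (V - W) \<times> (V - W)"
  proof
    fix a assume a: "a \<in> E'"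
    then have "\<not> meets W a" using QW by (auto simp: E'_def)
    then show "a \<in> (V - W) \<times> (V - W)" using a E by (auto simp: E'_def meets_def)
  qed
  have Euni: "E = E' \<union> Q \<union> F" using QE FE by (auto simp: E'_def)
  have excQ: "exc Q v = int (b v) - int (e v)" for v
  proof -
    have "exc Q v = (\<Sum>i<N. exc (arcs_of (p i)) v)"
      unfolding Q_def using p(2) by (intro exc_UN) auto
    also have "\<dots> = (\<Sum>i<N. of_bool (r i = v) - of_bool (u i = v))"
    proof (intro sum.cong refl)
      fix i assume "i \<in> {..<N}"
      then have "distinct (p i)" "p i \<noteq> []" "hd (p i) = r i" "last (p i) = u i" using p(1) by fastforce+
      then show "exc (arcs_of (p i)) v = of_bool (r i = v) - of_bool (u i = v)"
        by (simp add: exc_arcs_of eq_commute)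
    qed
    also have "\<dots> = int (card {i. i < N \<and> r i = v}) - int (card {i. i < N \<and> u i = v})"
      by (simp add: sum_subtractf sum.If_cases of_bool_def Int_def)
    finally show ?thesis using r(2) u(2) by simp
  qed
  have excE': "exc E' v = exc E v - int (b v) + int (e v) - of_bool (v \<in> S)" if "v \<in> V - W" for v
  proof -
    have "exc E' v = exc E v - exc (Q \<union> F) v"
      unfolding E'_def using fE QE FE by (intro exc_Diff) auto
    moreover have "exc (Q \<union> F) v = exc Q v + exc F v" using fQ fF QF by (rule exc_Un)
    moreover have "exc F v = of_bool (v \<in> S)" using that by (simp add: exc_def outF inF)
    ultimately show ?thesis using excQ[of v] by simp
  qed
  have eU: "e v = 0" if "v \<in> Up" for v using e(2) that VU by auto
  have bU: "b v = 0" if "v \<in> Um" for v using b0[of v] that VU RV by auto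
  have exS: "exc E' v = -1" if "v \<in> S" for v
  proof -
    have v: "v \<in> Up" "v \<in> V - W" using that SUp SW VU(1) by blast+
    show ?thesis using excE'[OF v(2)] sUp[OF v(1)] eU[OF v(1)] that by (simp add: b_def)
  qed
  have exUp: "exc E' v = int (s v) - int (b v)" "exc E' v \<ge> 1" if "v \<in> Up - S" for v
  proof -
    have v: "v \<in> V - W" using that halfW VU by auto
    show 1: "exc E' v = int (s v) - int (b v)"
      using excE'[OF v] that sUp[of v] eU[of v] by auto
    show "exc E' v \<ge> 1" using 1 bR(1)[of v] s1(1)[of v] that VU by (auto simp: b_def)
  qed
  have exUm: "exc E' v = - int (s v) + int (e v)" "exc E' v \<le> -1" if "v \<in> Um - W" for v
  proof -
    have v: "v \<in> V - W" "v \<notin> S" using that VU SUp by auto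
    show 1: "exc E' v = - int (s v) + int (e v)"
      using excE'[OF v(1)] that sUm[of v] bU[of v] v by auto
    show "exc E' v \<le> -1" using 1 e(1)[of v] s1(1)[of v] v by auto
  qed
  have split: "V - W = (Up - S) \<union> S \<union> (Um - W)" using VU SUp halfW SW by auto

  \<comment> \<open>The positive part of the excess falls by \<open>b v\<close> at each v, also in
    \<open>S\<close>, where it falls from \<open>s v\<close> to max (-1) 0 = 0. Vertices of
    \<open>W\<close> contribute nothing. So the total falls by N, exactly the number of linked
    paths.\<close>
  have tot': "total_exc V E = total_exc (V - W) E' + int N"
  proof -
    have "max (exc E v) 0 = max (exc E' v) 0 + int (b v)" if v: "v \<in> V - W" for v
    proof -
      consider "v \<in> Up - S" | "v \<in> S" | "v \<in> Um - W" using v unfolding split by blast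
      then show ?thesis
      proof cases
        case 1
        then have "exc E v = int (s v)" "max (exc E' v) 0 = exc E' v" using sUp exUp(2)[OF 1] by auto
        then show ?thesis using exUp(1)[OF 1] by simp
      next
        case 2
        then have "exc E v = int (s v)" "b v = s v" using sUp SUp by (auto simp: b_def)
        then show ?thesis using exS[OF 2] by simp
      next
        case 3
        then have "exc E v \<le> 0" "b v = 0" using sUm bU by auto
        then show ?thesis using exUm(2)[OF 3] by simp
      qed
    qed
    then have "(\<Sum>v\<in>V - W. max (exc E v) 0) = total_exc (V - W) E' + (\<Sum>v\<in>V - W. int (b v))"
      by (simp add: total_exc_def sum.distrib)
    moreover have "(\<Sum>v\<in>V - W. max (exc E v) 0) = total_exc V E"
      unfolding total_exc_def using V W' by (intro sum.mono_neutral_left) (auto simp: Um_def)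
    moreover have "sum b (V - W) = sum b V"
      using V W' bU by (intro sum.mono_neutral_left) auto
    ultimately show ?thesis using sumb by (simp flip: of_nat_sum)
  qed
  have no': "\<not> (\<exists>P. perfect_paths (V - W) E' P)"
  proof
    assume "\<exists>P. perfect_paths (V - W) E' P"
    then obtain P where P: "perfect_paths (V - W) E' P" by blast
    have "\<exists>P. perfect_paths V E P"
    proof (rule perfect_paths_extend[OF V(1) E'V P, of S f N p])
      show "S \<subseteq> V - W" using split by auto
      show "f ` S \<subseteq> W" using f by auto
      show "E = E' \<union> (\<Union>i<N. arcs_of (p i)) \<union> (\<lambda>v. (v, f v)) ` S"
        using Euni by (simp add: Q_def F_def)
      show "E' \<inter> (\<Union>i<N. arcs_of (p i)) = {}" by (auto simp: E'_def Q_def)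
      show "(\<lambda>v. (v, f v)) ` S \<inter> (\<Union>i<N. arcs_of (p i)) = {}"
        using QF by (auto simp: F_def Q_def)
    qed (use exS p tot' in auto)
    then show False using noperf by simp
  qed

  \<comment> \<open>Size, degrees, excess and balance after the reduction\<close>
  have cVW: "card (V - W) = n - card W" "card W \<le> n"
    using WV V by (auto simp: card_Diff_subset card_mono)
  have deg': "real (out_deg E' v + in_deg E' v) \<ge> (1 - 8 * \<epsilon>) * n" if "v \<in> V - W" for v
  proof -
    have "out_deg E v = out_deg E' v + out_deg (Q \<union> F) v" "in_deg E v = in_deg E' v + in_deg (Q \<union> F) v"
    proof -
      have fin: "finite E'" "finite (Q \<union> F)" "E' \<inter> (Q \<union> F) = {}"
        using fE fQ fF by (auto simp: E'_def)
      have eq: "E = E' \<union> (Q \<union> F)" using Euni by blast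
      show "out_deg E v = out_deg E' v + out_deg (Q \<union> F) v"
        by (subst eq) (rule out_deg_Un[OF fin])
      show "in_deg E v = in_deg E' v + in_deg (Q \<union> F) v"
        by (subst eq) (rule in_deg_Un[OF fin])
    qed
    moreover have "out_deg (Q \<union> F) v = out_deg Q v + of_bool (v \<in> S)" "in_deg (Q \<union> F) v = in_deg Q v"
      using out_deg_Un[OF fQ fF QF, of v] in_deg_Un[OF fQ fF QF, of v] that by (auto simp: outF inF)
    moreover have "real (out_deg Q v) \<le> 3 * \<epsilon> * n" "real (in_deg Q v) \<le> 3 * \<epsilon> * n"
      using p(4) that by (auto simp: Q_def)
    moreover have "(1 - \<epsilon>) * n \<le> real (out_deg E v + in_deg E v)" using deg that by auto
    moreover have "real (of_bool (v \<in> S)) \<le> \<epsilon> * n" using en by simp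
    \<comment> \<open>The 8 is 1 + 3 + 3 for the original defect and the linked paths, plus 1 for
      the single arc of \<open>F\<close> at a vertex of \<open>S\<close>.\<close>
    ultimately show ?thesis by (simp add: algebra_simps)
  qed
  have exc': "1 \<le> \<bar>exc E' v\<bar> \<and> real_of_int \<bar>exc E' v\<bar> \<le> \<alpha> * n" if v: "v \<in> V - W" for v
  proof -
    have "1 \<le> \<bar>exc E' v\<bar> \<and> \<bar>exc E' v\<bar> \<le> int (s v)"
    proof -
      consider "v \<in> Up - S" | "v \<in> S" | "v \<in> Um - W" using v unfolding split by blast
      then show ?thesis
      proof cases
        case 1
        then show ?thesis using exUp[OF 1] by linarith
      next
        case 2
        then show ?thesis using exS[OF 2] s1(1)[of v] v by simp
      next
        case 3
        then show ?thesis using exUm[OF 3] by linarith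
      qed
    qed
    then have "1 \<le> \<bar>exc E' v\<bar>" "real_of_int \<bar>exc E' v\<bar> \<le> real (s v)" by linarith+
    then show ?thesis using s1(2)[of v] v by auto
  qed
  \<comment> \<open>The new total is the excess of \<open>Up\<close> without \<open>S\<close>, less
    5 n. It is at least \<open>sum s R - 5 * n\<close>, and lam * C >= 1000 absorbs the 5 n.\<close>
  have big: "real_of_int (total_exc (V - W) E') \<ge> lam * C * n / 32"
  proof -
    have "sum s (R \<union> S) \<le> sum s Up" using fU RV by (intro sum_mono2) auto
    then have "sum s R + sum s S \<le> sum s Up" using fR fS RV by (simp add: sum.union_disjoint)
    then have "int (sum s R) - 5 * int n \<le> total_exc (V - W) E'"
      using tot' totUp unfolding N_def by linarith
    then have "real (sum s R) - 5 * n \<le> real_of_int (total_exc (V - W) E')" by linarith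
    then show ?thesis using R(3) Cln nn by linarith
  qed
  have pos: "0 < exc E' v" "\<not> exc E' v < 0" if "v \<in> Up - S" for v
    using exUp(2)[OF that] by linarith+
  have neg: "exc E' v < 0" "\<not> 0 < exc E' v" if "v \<in> S \<union> (Um - W)" for v
    using that exS[of v] exUm(2)[of v] by auto
  have Up': "{v \<in> V - W. exc E' v > 0} = Up - S"
    unfolding split using pos neg by blast
  have Um': "{v \<in> V - W. exc E' v < 0} = S \<union> (Um - W)"
    unfolding split using pos neg by blast
  have "card (Up - S) = card Up - card S" "card S \<le> card Up"
    using SUp fU fS by (auto intro!: card_Diff_subset card_mono)
  moreover have "card (S \<union> (Um - W)) = card S + (card Um - card W)" "card W \<le> card Um"
  proof -
    have "card (S \<union> (Um - W)) = card S + card (Um - W)"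
      using fS fU SUp VU by (intro card_Un_disjoint) auto
    then show "card (S \<union> (Um - W)) = card S + (card Um - card W)"
      using W' WV by (simp add: card_Diff_subset)
    show "card W \<le> card Um" using W' fU by (intro card_mono)
  qed
  ultimately have diff: "real (card (Up - S)) - real (card (S \<union> (Um - W))) = d - 2 * card S + card W"
    by (simp add: d_def of_nat_diff)
  \<comment> \<open>By the choice of \<open>W\<close>, |S| lies at most 2 * alpha * n below t; each
    vertex of \<open>S\<close> counts twice because it changes sides.\<close>
  have "d - 2 * real (card S) + card W \<le> lam * n + 4 * (\<alpha> * n) + \<beta> * n"
    using W'(4) cW unfolding cS t_def by linarith
  moreover have "d - 2 * real (card S) + card W \<ge> 0"
    using W'(3) ln unfolding cS t_def by linarith
  moreover have "lam * n + 4 * (\<alpha> * n) + \<beta> * n \<le> 2 * lam * card (V - W)"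
  proof -
    have "real (card (V - W)) \<ge> n - \<beta> * n" using cVW cW by (simp add: of_nat_diff)
    then have "lam * card (V - W) \<ge> lam * (n - \<beta> * n)" using lam by (intro mult_left_mono) auto
    moreover have "lam * (\<beta> * n) \<le> 1 * (\<beta> * n)" using lam be by (intro mult_right_mono) auto
    ultimately have "2 * lam * card (V - W) \<ge> 2 * (lam * n) - 2 * (\<beta> * n)"
      by (simp add: algebra_simps)
    then show ?thesis using aln ben eln nn ln lam by linarith
  qed
  ultimately have bal: "\<bar>real (card {v \<in> V - W. exc E' v < 0}) - real (card {v \<in> V - W. exc E' v > 0})\<bar>
      \<le> 2 * lam * card (V - W)"
    unfolding Up' Um' using diff by linarith
  have "(1 - \<beta>) * n \<le> card (V - W)" using cVW cW by (simp add: of_nat_diff algebra_simps)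
  moreover have "even (card (V - W))" using cVW V'(3) W'(2) by simp
  ultimately show ?thesis
    using E'V no' deg' exc' big bal
    by (intro exI[of _ "V - W"] exI[of _ E']) (auto simp: E'_def)
qed

section \<open>Translation to digraphs\<close>

lemma total_degree_eq: "total_degree D v = out_deg (parcs D) v + in_deg (parcs D) v"
  by (simp add: total_degree_def out_degree_def in_degree_def out_arcs_def in_arcs_def
      out_deg_def in_deg_def)

lemma vertex_excess_eq: "vertex_excess D v = exc (parcs D) v"
  by (simp add: vertex_excess_def exc_def out_degree_def in_degree_def out_arcs_def in_arcs_def
      out_deg_def in_deg_def)

lemma excess_eq: "excess D = total_exc (pverts D) (parcs D)"
  by (simp add: excess_def total_exc_def vertex_excess_eq)

lemma pawalk_verts_zip_tl: "xs \<noteq> [] \<Longrightarrow> pawalk_verts (hd xs) (zip xs (tl xs)) = xs"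
  by (induction xs rule: induct_list012) auto

lemma pcas_zip_tl: "xs \<noteq> [] \<Longrightarrow> pcas (hd xs) (zip xs (tl xs)) (last xs)"
  by (induction xs rule: induct_list012) auto

lemma zip_tl_pawalk_verts: "pcas u p v \<Longrightarrow> zip (pawalk_verts u p) (tl (pawalk_verts u p)) = p"
proof (induction p arbitrary: u)
  case (Cons e p)
  then show ?case by (cases p) auto
qed simp

lemma length_pawalk_verts: "length (pawalk_verts u p) = Suc (length p)"
  by (induction p arbitrary: u) auto

text \<open>Vertex lists become arc lists by \<open>zip xs (tl xs)\<close> and come back by
  \<open>pawalk_verts\<close>. Disjoint nonempty arc sets make both passages injective on a
  decomposition, so the number of paths is kept.\<close>

lemma perfect_decomposition_iff:
  assumes fin: "finite (parcs D)" and wf: "parcs D \<subseteq> pverts D \<times> pverts D"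
  shows "(\<exists>P. perfect_decomposition D P) \<longleftrightarrow> (\<exists>P. perfect_paths (pverts D) (parcs D) P)"
proof
  assume "\<exists>P. perfect_decomposition D P"
  then obtain P where P: "perfect_decomposition D P" by blast
  have dj: "disjoint_family_on set P" and un: "(\<Union>p\<in>P. set p) = parcs D"
    and cP: "int (card P) = excess D" and ne: "\<And>p. p \<in> P \<Longrightarrow> p \<noteq> []"
    using P by (auto simp: perfect_decomposition_def)
  \<comment> \<open>Nonempty disjoint subsets of a finite arc set: this yields the finiteness that
    \<open>perfect_paths\<close> demands.\<close>
  have "inj_on set P"
    using dj ne by (fastforce simp: inj_on_def disjoint_family_on_def)
  moreover have "finite (set ` P)" using un fin by (metis Union_upper finite_Pow_iff finite_subset subsetI PowI)
  ultimately have finP: "finite P" using finite_imageD by blast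
  have "\<exists>u v. pre_digraph.apath (with_proj D) u p v" if "p \<in> P" for p
    using P that by (auto simp: perfect_decomposition_def)
  then obtain s e where ap: "\<And>p. p \<in> P \<Longrightarrow> pre_digraph.apath (with_proj D) (s p) p (e p)"
    by metis
  have pp: "pcas (s p) p (e p)" "distinct (pawalk_verts (s p) p)" if "p \<in> P" for p
    using ap[OF that] by (simp_all add: pre_digraph.apath_def pre_digraph.awalk_def
        cas_with_proj_eq awalk_verts_with_proj_eq)
  define q where "q p = pawalk_verts (s p) p" for p
  have arcs: "arcs_of (q p) = set p" if "p \<in> P" for p
    using zip_tl_pawalk_verts[OF pp(1)[OF that]] by (simp add: q_def arcs_of_def)
  have "perfect_paths (pverts D) (parcs D) (q ` P)"
  proof (rule perfect_paths_family[OF finP])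
    show "distinct (q p) \<and> 2 \<le> length (q p)" if "p \<in> P" for p
      using pp(2)[OF that] ne[OF that] by (cases p) (auto simp: q_def length_pawalk_verts)
    show "disjoint_family_on (\<lambda>p. arcs_of (q p)) P"
      using dj arcs by (simp add: disjoint_family_on_def)
    show "(\<Union>p\<in>P. arcs_of (q p)) = parcs D" using un arcs by simp
    show "int (card P) = total_exc (pverts D) (parcs D)" using cP by (simp add: excess_eq)
  qed
  then show "\<exists>P. perfect_paths (pverts D) (parcs D) P" by blast
next
  assume "\<exists>P. perfect_paths (pverts D) (parcs D) P"
  then obtain P where P: "perfect_paths (pverts D) (parcs D) P" by blast
  define q where "q xs = zip xs (tl xs)" for xs :: "'a list"
  have set_q: "set (q xs) = arcs_of xs" for xs by (simp add: q_def arcs_of_def)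
  have Pd: "distinct xs" "length xs \<ge> 2" "arcs_of xs \<subseteq> parcs D" if "xs \<in> P" for xs
    using P that by (auto simp: perfect_paths_def)
  have ne: "q xs \<noteq> []" if "xs \<in> P" for xs
    using Pd(2)[OF that] by (cases xs; cases "tl xs") (auto simp: q_def)
  have dj: "arcs_of xs \<inter> arcs_of ys = {}" if "xs \<in> P" "ys \<in> P" "xs \<noteq> ys" for xs ys
    using P that by (auto simp: perfect_paths_def disjoint_family_on_def)
  have inj: "inj_on q P"
  proof (rule inj_onI, rule ccontr)
    fix xs ys assume *: "xs \<in> P" "ys \<in> P" "q xs = q ys" "xs \<noteq> ys"
    then have "arcs_of xs = {}" using dj[of xs ys] set_q by (metis Int_absorb)
    then show False using ne[OF *(1)] set_q[of xs] by simp
  qed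
  have "perfect_decomposition D (q ` P)"
    unfolding perfect_decomposition_def
  proof (intro conjI ballI)
    fix p assume "p \<in> q ` P"
    then obtain xs where xs: "xs \<in> P" "p = q xs" by blast
    show "p \<noteq> []" using ne xs by simp
    have "xs \<noteq> []" using Pd(2)[OF xs(1)] by auto
    have "hd xs \<in> pverts D"
      using Pd(2,3)[OF xs(1)] wf by (cases xs; cases "tl xs") auto
    then have "pre_digraph.apath (with_proj D) (hd xs) p (last xs)"
      using Pd[OF xs(1)] \<open>xs \<noteq> []\<close> pcas_zip_tl[of xs] pawalk_verts_zip_tl[of xs]
      by (simp add: xs(2) q_def pre_digraph.apath_def pre_digraph.awalk_def
          cas_with_proj_eq awalk_verts_with_proj_eq arcs_of_def)
    then show "\<exists>u v. pre_digraph.apath (with_proj D) u p v" by blast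
  next
    show "disjoint_family_on set (q ` P)"
    proof (unfold disjoint_family_on_def, intro ballI impI)
      fix a b assume *: "a \<in> q ` P" "b \<in> q ` P" "a \<noteq> b"
      then obtain xs ys where "xs \<in> P" "ys \<in> P" "a = q xs" "b = q ys" by blast
      moreover from this have "xs \<noteq> ys" using *(3) by auto
      ultimately show "set a \<inter> set b = {}" using dj[of xs ys] set_q by simp
    qed
    show "(\<Union>p\<in>q ` P. set p) = parcs D" using P set_q by (simp add: perfect_paths_def)
    show "int (card (q ` P)) = excess D"
      using P inj by (simp add: card_image excess_eq perfect_paths_def)
  qed
  then show "\<exists>P. perfect_decomposition D P" by blast
qed

lemma perfect_paths_converse_iff:
  assumes "finite V" "E \<subseteq> V \<times> V"
  shows "(\<exists>P. perfect_paths V (E\<inverse>) P) \<longleftrightarrow> (\<exists>P. perfect_paths V E P)"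
proof -
  have "E\<inverse> \<subseteq> V \<times> V" using assms by auto
  then show ?thesis
    using perfect_paths_converse[OF assms] perfect_paths_converse[of V "E\<inverse>"] assms by auto
qed

text \<open>Reversal swaps the two sign classes and preserves total degrees, total excess and
  perfect decomposability, so one unbalanced case follows from the other. If the classes differ by
  at most 2 * lam * n, the digraph itself has all the required properties.\<close>

lemma reduction:
  fixes V :: "'a set" and E :: "('a \<times> 'a) set" and C \<alpha> \<beta> \<epsilon> lam :: real
  assumes V: "finite V" "card V = n" "even n" and E: "E \<subseteq> V \<times> V"
    and anti: "\<And>a b. (a, b) \<in> E \<Longrightarrow> (b, a) \<notin> E"
    and deg: "\<And>v. v \<in> V \<Longrightarrow> real (out_deg E v + in_deg E v) \<ge> (1 - \<epsilon>) * n"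
    and exc: "\<And>v. v \<in> V \<Longrightarrow> 1 \<le> \<bar>exc E v\<bar> \<and> real_of_int \<bar>exc E v\<bar> \<le> \<alpha> * n"
    and tot: "real_of_int (total_exc V E) \<ge> C * n"
    and lam: "0 < lam" "lam \<le> 1 / 1000" and eps: "0 < \<epsilon>" "\<epsilon> \<le> lam / 1000"
    and al: "0 < \<alpha>" "\<alpha> \<le> \<epsilon>\<^sup>2 / 1000" and be: "0 < \<beta>" "\<beta> \<le> \<epsilon>\<^sup>2 / 1000"
    and C: "C > 0" "1 / C \<le> \<beta>" and n: "n > 0" "1 / real n \<le> 1 / C"
    and noperf: "\<not> (\<exists>P. perfect_paths V E P)"
  shows "\<exists>V' E'. V' \<subseteq> V \<and> E' \<subseteq> E \<and> E' \<subseteq> V' \<times> V' \<and> \<not> (\<exists>P. perfect_paths V' E' P) \<and>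
    real (card V') \<ge> (1 - \<beta>) * n \<and> even (card V') \<and>
    (\<forall>v\<in>V'. real (out_deg E' v + in_deg E' v) \<ge> (1 - 8 * \<epsilon>) * n) \<and>
    (\<forall>v\<in>V'. 1 \<le> \<bar>exc E' v\<bar> \<and> real_of_int \<bar>exc E' v\<bar> \<le> \<alpha> * n) \<and>
    real_of_int (total_exc V' E') \<ge> lam * C * n / 32 \<and>
    \<bar>real (card {v \<in> V'. exc E' v < 0}) - real (card {v \<in> V'. exc E' v > 0})\<bar> \<le> 2 * lam * card V'"
proof -
  let ?p = "card {v \<in> V. exc E v > 0}" and ?m = "card {v \<in> V. exc E v < 0}"
  consider "real ?p > ?m + 2 * lam * n" | "real ?m > ?p + 2 * lam * n" | "\<bar>real ?m - real ?p\<bar> \<le> 2 * lam * n"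
    by linarith
  then show ?thesis
  proof cases
    case 1
    show ?thesis by (rule unbalanced_reduction[OF V E anti deg exc tot 1 lam eps al be C n noperf])
  next
    case 2
    have Ec: "E\<inverse> \<subseteq> V \<times> V" using E by auto
    have "\<exists>V' E'. V' \<subseteq> V \<and> E' \<subseteq> E\<inverse> \<and> E' \<subseteq> V' \<times> V' \<and> \<not> (\<exists>P. perfect_paths V' E' P) \<and>
      real (card V') \<ge> (1 - \<beta>) * n \<and> even (card V') \<and>
      (\<forall>v\<in>V'. real (out_deg E' v + in_deg E' v) \<ge> (1 - 8 * \<epsilon>) * n) \<and>
      (\<forall>v\<in>V'. 1 \<le> \<bar>exc E' v\<bar> \<and> real_of_int \<bar>exc E' v\<bar> \<le> \<alpha> * n) \<and>
      real_of_int (total_exc V' E') \<ge> lam * C * n / 32 \<and>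
      \<bar>real (card {v \<in> V'. exc E' v < 0}) - real (card {v \<in> V'. exc E' v > 0})\<bar> \<le> 2 * lam * card V'"
    proof (rule unbalanced_reduction[OF V Ec _ _ _ _ _ lam eps al be C n])
      show "(b, a) \<notin> E\<inverse>" if "(a, b) \<in> E\<inverse>" for a b using anti that by auto
      show "(1 - \<epsilon>) * n \<le> real (out_deg (E\<inverse>) v + in_deg (E\<inverse>) v)" if "v \<in> V" for v
        using deg[OF that] by (simp add: out_deg_converse in_deg_converse add.commute)
      show "1 \<le> \<bar>exc (E\<inverse>) v\<bar> \<and> real_of_int \<bar>exc (E\<inverse>) v\<bar> \<le> \<alpha> * n" if "v \<in> V" for v
        using exc[OF that] by (simp add: exc_converse)
      show "C * n \<le> real_of_int (total_exc V (E\<inverse>))" using tot V E by (simp add: total_exc_converse)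
      show "real (card {v \<in> V. exc (E\<inverse>) v < 0}) + 2 * lam * n < card {v \<in> V. exc (E\<inverse>) v > 0}"
        using 2 by (simp add: exc_converse)
      show "\<not> (\<exists>P. perfect_paths V (E\<inverse>) P)" using noperf perfect_paths_converse_iff[OF V(1) E] by simp
    qed
    then obtain V' E' where R: "V' \<subseteq> V" "E' \<subseteq> E\<inverse>" "E' \<subseteq> V' \<times> V'" "\<not> (\<exists>P. perfect_paths V' E' P)"
      "real (card V') \<ge> (1 - \<beta>) * n" "even (card V')"
      "\<forall>v\<in>V'. real (out_deg E' v + in_deg E' v) \<ge> (1 - 8 * \<epsilon>) * n"
      "\<forall>v\<in>V'. 1 \<le> \<bar>exc E' v\<bar> \<and> real_of_int \<bar>exc E' v\<bar> \<le> \<alpha> * n"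
      "real_of_int (total_exc V' E') \<ge> lam * C * n / 32"
      "\<bar>real (card {v \<in> V'. exc E' v < 0}) - real (card {v \<in> V'. exc E' v > 0})\<bar> \<le> 2 * lam * card V'"
      by (elim exE conjE) (rule that)
    have fV': "finite V'" using R(1) V finite_subset by blast
    show ?thesis
    proof (intro exI[of _ V'] exI[of _ "E'\<inverse>"] conjI)
      show "E'\<inverse> \<subseteq> E" "E'\<inverse> \<subseteq> V' \<times> V'" using R(2,3) by auto
      show "\<not> (\<exists>P. perfect_paths V' (E'\<inverse>) P)"
        using R(4) perfect_paths_converse_iff[OF fV' R(3)] by simp
      show "\<forall>v\<in>V'. real (out_deg (E'\<inverse>) v + in_deg (E'\<inverse>) v) \<ge> (1 - 8 * \<epsilon>) * n"
        using R(7) by (simp add: out_deg_converse in_deg_converse add.commute)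
      show "\<forall>v\<in>V'. 1 \<le> \<bar>exc (E'\<inverse>) v\<bar> \<and> real_of_int \<bar>exc (E'\<inverse>) v\<bar> \<le> \<alpha> * n"
        using R(8) by (simp add: exc_converse)
      show "real_of_int (total_exc V' (E'\<inverse>)) \<ge> lam * C * n / 32"
        using R(9) fV' R(3) by (simp add: total_exc_converse)
      show "\<bar>real (card {v \<in> V'. exc (E'\<inverse>) v < 0}) - real (card {v \<in> V'. exc (E'\<inverse>) v > 0})\<bar>
        \<le> 2 * lam * card V'"
        using R(10) by (simp add: exc_converse abs_minus_commute)
    qed (use R in auto)
  next
    case 3
    have "lam * (C * n) / 32 \<le> C * n"
    proof -
      have "lam * (C * n) \<le> 32 * (C * n)" using lam C by (intro mult_right_mono) auto
      then show ?thesis by simp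
    qed
    then have "lam * C * n / 32 \<le> real_of_int (total_exc V E)" using tot by (simp add: mult.assoc)
    moreover have "(1 - 8 * \<epsilon>) * n \<le> (1 - \<epsilon>) * n" "(1 - \<beta>) * n \<le> 1 * real n"
      by (rule mult_right_mono, use eps be in simp, simp)+
    ultimately show ?thesis
      using V E deg exc noperf 3 by (intro exI[of _ V] exI[of _ E]) force
  qed
qed

theorem theorem6p5:
  shows "\<exists>f\<^sub>1 f\<^sub>2 f\<^sub>3 f\<^sub>4 f\<^sub>5 :: real \<Rightarrow> real.
    hierarchy_fun f\<^sub>1 \<and> hierarchy_fun f\<^sub>2 \<and> hierarchy_fun f\<^sub>3 \<and> hierarchy_fun f\<^sub>4 \<and> hierarchy_fun f\<^sub>5 \<and>
    (\<forall>(n :: nat) (C :: real) (\<alpha> :: real) (\<beta> :: real) (\<epsilon> :: real) (lam :: real) (\<epsilon>' :: real)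
      (D :: 'a pair_pre_digraph).
      n > 0 \<and> C > 0 \<and> \<alpha> > 0 \<and> \<beta> > 0 \<and> \<epsilon> > 0 \<and> lam > 0 \<and> \<epsilon>' > 0 \<and>
      lam \<le> f\<^sub>5 1 \<and> \<epsilon>' \<le> f\<^sub>5 1 \<and>
      \<epsilon> \<le> f\<^sub>4 lam \<and> \<epsilon> \<le> f\<^sub>4 \<epsilon>' \<and>
      \<alpha> \<le> f\<^sub>3 \<epsilon> \<and> \<beta> \<le> f\<^sub>3 \<epsilon> \<and>
      1 / C \<le> f\<^sub>2 \<alpha> \<and> 1 / C \<le> f\<^sub>2 \<beta> \<and>
      1 / real n \<le> f\<^sub>1 (1 / C) \<and>
      even n \<and>
      oriented_graph D \<and> card (pverts D) = n \<and>
      real_of_int (excess D) \<ge> C * real n \<and>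
      real (min_degree D) \<ge> (1 - \<epsilon>) * real n \<and>
      (\<forall>v\<in>pverts D. 1 \<le> \<bar>vertex_excess D v\<bar> \<and> real_of_int \<bar>vertex_excess D v\<bar> \<le> \<alpha> * real n) \<and>
      \<not> (\<exists>P. perfect_decomposition D P)
      \<longrightarrow>
      (\<exists>D' :: 'a pair_pre_digraph. subgraph (with_proj D') (with_proj D) \<and>
        \<not> (\<exists>P. perfect_decomposition D' P) \<and>
        real (card (pverts D')) \<ge> (1 - \<beta>) * real n \<and> even (card (pverts D')) \<and>
        real (min_degree D') \<ge> (1 - \<epsilon>' / 2) * real n \<and>
        (1 - \<epsilon>' / 2) * real n \<ge> (1 - \<epsilon>') * real (card (pverts D')) \<and>
        (\<forall>v\<in>pverts D'. 1 \<le> \<bar>vertex_excess D' v\<bar> \<and>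
          real_of_int \<bar>vertex_excess D' v\<bar> \<le> \<alpha> * real n) \<and>
        \<alpha> * real n \<le> 2 * \<alpha> * real (card (pverts D')) \<and>
        real_of_int (excess D') \<ge> lam * C * real n / 32 \<and>
        lam * C * real n / 32 \<ge> lam * C * real (card (pverts D')) / 32 \<and>
        \<bar>real (card (U_minus D')) - real (card (U_plus D'))\<bar> \<le> 2 * lam * real (card (pverts D'))))"
\<comment> \<open>The square comes from the linkage: with N <= alpha * n^2 and |W| <= beta * n, its
  bound needs 8 alpha + 24 beta <= eps^2. The linear function makes eps * n negligible against lam *
  n and eps' * n, the constant provides absolute smallness, and the identities give 1/n <= 1/C <=
  beta.\<close>
proof (rule exI[of _ "\<lambda>x. x"], rule exI[of _ "\<lambda>x. x"], rule exI[of _ "\<lambda>x. x\<^sup>2 / 1000"],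
    rule exI[of _ "\<lambda>x. x / 1000"], rule exI[of _ "\<lambda>_. 1 / 1000"],
    intro conjI allI impI; (elim conjE)?)
  show "hierarchy_fun (\<lambda>x. x)" "hierarchy_fun (\<lambda>x. x)" "hierarchy_fun (\<lambda>x. x / 1000)"
    "hierarchy_fun (\<lambda>_. 1 / 1000)"
    by (auto simp: hierarchy_fun_def mono_on_def)
  show "hierarchy_fun (\<lambda>x. x\<^sup>2 / 1000)"
  proof -
    have "x\<^sup>2 \<le> 1" if "0 < x" "x \<le> 1" for x :: real using that by (simp add: power_le_one)
    then show ?thesis by (fastforce simp: hierarchy_fun_def mono_on_def intro: power_mono)
  qed
  fix n :: nat and C \<alpha> \<beta> \<epsilon> lam \<epsilon>' :: real and D :: "'a pair_pre_digraph"
  assume pos: "n > 0" "C > 0" "\<alpha> > 0" "\<beta> > 0" "\<epsilon> > 0" "lam > 0" "\<epsilon>' > 0"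
    and lam: "lam \<le> 1 / 1000" "\<epsilon>' \<le> 1 / 1000" and eps: "\<epsilon> \<le> lam / 1000" "\<epsilon> \<le> \<epsilon>' / 1000"
    and al: "\<alpha> \<le> \<epsilon>\<^sup>2 / 1000" "\<beta> \<le> \<epsilon>\<^sup>2 / 1000" and C: "1 / C \<le> \<alpha>" "1 / C \<le> \<beta>"
    and n: "1 / real n \<le> 1 / C" "even n"
    and D: "oriented_graph D" "card (pverts D) = n" "real_of_int (excess D) \<ge> C * real n"
      "real (min_degree D) \<ge> (1 - \<epsilon>) * real n"
      "\<forall>v\<in>pverts D. 1 \<le> \<bar>vertex_excess D v\<bar> \<and> real_of_int \<bar>vertex_excess D v\<bar> \<le> \<alpha> * real n"
      "\<not> (\<exists>P. perfect_decomposition D P)"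
  interpret oriented_graph D by (rule D)
  have fin: "finite (pverts D)" "finite (parcs D)" by (rule pair_finite_verts pair_finite_arcs)+
  have wf: "parcs D \<subseteq> pverts D \<times> pverts D" using arc_fst_in_verts arc_snd_in_verts by force
  have deg: "(1 - \<epsilon>) * real n \<le> real (out_deg (parcs D) v + in_deg (parcs D) v)" if "v \<in> pverts D" for v
  proof -
    have "min_degree D \<le> total_degree D v"
      unfolding min_degree_def using fin that by (intro Min_le) auto
    then have "real (min_degree D) \<le> real (total_degree D v)" by simp
    then show ?thesis using D(4) by (simp add: total_degree_eq)
  qed
  have "\<exists>V' E'. V' \<subseteq> pverts D \<and> E' \<subseteq> parcs D \<and> E' \<subseteq> V' \<times> V' \<and> \<not> (\<exists>P. perfect_paths V' E' P) \<and>
    real (card V') \<ge> (1 - \<beta>) * n \<and> even (card V') \<and>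
    (\<forall>v\<in>V'. real (out_deg E' v + in_deg E' v) \<ge> (1 - 8 * \<epsilon>) * n) \<and>
    (\<forall>v\<in>V'. 1 \<le> \<bar>exc E' v\<bar> \<and> real_of_int \<bar>exc E' v\<bar> \<le> \<alpha> * n) \<and>
    real_of_int (total_exc V' E') \<ge> lam * C * n / 32 \<and>
    \<bar>real (card {v \<in> V'. exc E' v < 0}) - real (card {v \<in> V'. exc E' v > 0})\<bar> \<le> 2 * lam * card V'"
  proof (rule reduction[OF fin(1) D(2) n(2) wf no_antiparallel deg])
    show "1 \<le> \<bar>exc (parcs D) v\<bar> \<and> real_of_int \<bar>exc (parcs D) v\<bar> \<le> \<alpha> * n" if "v \<in> pverts D" for v
      using D(5) that by (simp add: vertex_excess_eq)
    show "C * n \<le> real_of_int (total_exc (pverts D) (parcs D))" using D(3) by (simp add: excess_eq)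
    show "\<not> (\<exists>P. perfect_paths (pverts D) (parcs D) P)"
      using D(6) perfect_decomposition_iff[OF fin(2) wf] by simp
  qed (use pos lam eps al C n in auto)
  then obtain V' E' where R: "V' \<subseteq> pverts D" "E' \<subseteq> parcs D" "E' \<subseteq> V' \<times> V'"
    "\<not> (\<exists>P. perfect_paths V' E' P)" "real (card V') \<ge> (1 - \<beta>) * n" "even (card V')"
    "\<forall>v\<in>V'. real (out_deg E' v + in_deg E' v) \<ge> (1 - 8 * \<epsilon>) * n"
    "\<forall>v\<in>V'. 1 \<le> \<bar>exc E' v\<bar> \<and> real_of_int \<bar>exc E' v\<bar> \<le> \<alpha> * n"
    "real_of_int (total_exc V' E') \<ge> lam * C * n / 32"
    "\<bar>real (card {v \<in> V'. exc E' v < 0}) - real (card {v \<in> V'. exc E' v > 0})\<bar> \<le> 2 * lam * card V'"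
    by (elim exE conjE) (rule that)
  define D' where "D' = \<lparr>pverts = V', parcs = E'\<rparr>"
  have D': "pverts D' = V'" "parcs D' = E'" by (simp_all add: D'_def)
  have fV': "finite V'" and fE': "finite E'" using R(1,2) fin finite_subset by blast+
  have le: "card V' \<le> n" using R(1) fin D(2) card_mono by blast
  have be: "\<beta> \<le> 1 / 2"
  proof -
    have "\<epsilon> \<le> 1" using eps lam by linarith
    then have "\<epsilon>\<^sup>2 \<le> 1" using pos by (simp add: power_le_one)
    then show ?thesis using al by linarith
  qed
  have half: "real n / 2 \<le> real (card V')"
  proof -
    have "1 / 2 * real n \<le> (1 - \<beta>) * real n" using be by (intro mult_right_mono) auto
    then show ?thesis using R(5) by linarith
  qed
  have "V' \<noteq> {}" using half pos by auto
  show "\<exists>D' :: 'a pair_pre_digraph. subgraph (with_proj D') (with_proj D) \<and>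
        \<not> (\<exists>P. perfect_decomposition D' P) \<and>
        real (card (pverts D')) \<ge> (1 - \<beta>) * real n \<and> even (card (pverts D')) \<and>
        real (min_degree D') \<ge> (1 - \<epsilon>' / 2) * real n \<and>
        (1 - \<epsilon>' / 2) * real n \<ge> (1 - \<epsilon>') * real (card (pverts D')) \<and>
        (\<forall>v\<in>pverts D'. 1 \<le> \<bar>vertex_excess D' v\<bar> \<and>
          real_of_int \<bar>vertex_excess D' v\<bar> \<le> \<alpha> * real n) \<and>
        \<alpha> * real n \<le> 2 * \<alpha> * real (card (pverts D')) \<and>
        real_of_int (excess D') \<ge> lam * C * real n / 32 \<and>
        lam * C * real n / 32 \<ge> lam * C * real (card (pverts D')) / 32 \<and>
        \<bar>real (card (U_minus D')) - real (card (U_plus D'))\<bar> \<le> 2 * lam * real (card (pverts D'))"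
  proof (intro exI[of _ D'] conjI)
    have "wf_digraph (with_proj D')"
      using R(3) by unfold_locales (auto simp: D')
    moreover have "wf_digraph (with_proj D)"
      using wf by unfold_locales auto
    ultimately show "subgraph (with_proj D') (with_proj D)"
      using R(1,2) by (simp add: subgraph_def compatible_def D')
    show "\<not> (\<exists>P. perfect_decomposition D' P)"
      using perfect_decomposition_iff[of D'] fE' R(3,4) by (simp add: D')
    show "(1 - \<epsilon>' / 2) * real n \<le> real (min_degree D')"
    proof -
      have "min_degree D' \<in> total_degree D' ` V'"
        unfolding min_degree_def D' using fV' \<open>V' \<noteq> {}\<close> by (intro Min_in) auto
      then obtain v where v: "v \<in> V'" "min_degree D' = out_deg E' v + in_deg E' v"
        by (auto simp: total_degree_eq D')
      \<comment> \<open>The hierarchy gives 8 * eps <= eps' / 2.\<close>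
      have "(1 - \<epsilon>' / 2) * real n \<le> (1 - 8 * \<epsilon>) * real n"
        using eps pos by (intro mult_right_mono) auto
      then show ?thesis using R(7) v by fastforce
    qed
    show "(1 - \<epsilon>') * real (card (pverts D')) \<le> (1 - \<epsilon>' / 2) * real n"
      using le pos lam by (intro mult_mono) (auto simp: D')
    show "\<alpha> * real n \<le> 2 * \<alpha> * real (card (pverts D'))"
      using half pos by (simp add: D' field_simps)
    show "lam * C * real (card (pverts D')) / 32 \<le> lam * C * real n / 32"
      using le pos by (simp add: D')
    show "\<bar>real (card (U_minus D')) - real (card (U_plus D'))\<bar> \<le> 2 * lam * real (card (pverts D'))"
      using R(10) by (simp add: U_minus_def U_plus_def vertex_excess_eq D')
  qed (use R in \<open>auto simp: D' vertex_excess_eq excess_eq\<close>)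
qed

end
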